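(* Let ${\bf a},{\bf b}\in(2\mathbb N)^p$ and ${\bf c}=(c_1,\ldots,c_q)\in(2\mathbb N)^q$, and let $n\ge\max(2,p+q)$ be an integer. Then $$\Phi_n\begin{pmatrix}{\bf a}&{\bf c}\\ {\bf b}&0\end{pmatrix}=\Phi_n\begin{pmatrix}{\bf a}&\Sigma c_i\\ {\bf b}&0\end{pmatrix},$$ where on the left the second row ends with $q$ zeros and on the right the matrix has $p+1$ columns, the last being $(\sum_i c_i,0)^T$.
   Context: Double factorial convention: for an integer $m\ge0$, $m!!=(m-1)(m-3)\cdots$, the product of the positive integers $\le m-1$ of the parity of $m-1$ (empty product $=1$). For a $2\times q$ matrix with nonnegative integer entries and $n\ge\max(2,q)$, $I_n\begin{pmatrix}{\bf a}\\{\bf b}\end{pmatrix}=\int_{O_n}\prod_j u_{1j}^{a_j}u_{2j}^{b_j}\,du$ (Haar probability measure) and $\Phi_n\begin{pmatrix}{\bf a}\\ {\bf b}\end{pmatrix}=\frac{(\Sigma a_i+n-2)!!\,(\Sigma b_i+n-2)!!}{(n-2)!!^2\,\prod a_i!!\,\prod b_i!!}\,I_n\begin{pmatrix}{\bf a}\\ {\bf b}\end{pmatrix}$. *)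

theory Defs
  imports "HOL-Probability.Probability"
begin

text \<open>Paper's double factorial: m!! = (m-1)(m-3)... (empty product = 1).\<close>
fun dfact :: "nat \<Rightarrow> nat" where
  "dfact 0 = 1"
| "dfact (Suc 0) = 1"
| "dfact (Suc (Suc m)) = Suc m * dfact m"

text \<open>Real n x n matrices are represented as functions nat => nat => real,
  zero outside the index range {0..<n} x {0..<n}. Rows/columns are 0-based.\<close>
definition orth_mats :: "nat \<Rightarrow> (nat \<Rightarrow> nat \<Rightarrow> real) set" where
  "orth_mats n = {U. (\<forall>i j. (n \<le> i \<or> n \<le> j) \<longrightarrow> U i j = 0) \<and>
     (\<forall>i<n. \<forall>k<n. (\<Sum>j<n. U i j * U k j) = (if i = k then 1 else 0))}"

definition mat_mult :: "nat \<Rightarrow> (nat \<Rightarrow> nat \<Rightarrow> real) \<Rightarrow> (nat \<Rightarrow> nat \<Rightarrow> real) \<Rightarrow> (nat \<Rightarrow> nat \<Rightarrow> real)" where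
  "mat_mult n A B = (\<lambda>i k. if i < n \<and> k < n then (\<Sum>j<n. A i j * B j k) else 0)"

definition is_haar_On :: "nat \<Rightarrow> (nat \<Rightarrow> nat \<Rightarrow> real) measure \<Rightarrow> bool" where
  "is_haar_On n \<mu> \<longleftrightarrow> prob_space \<mu> \<and>
     sets \<mu> = sets (restrict_space borel (orth_mats n)) \<and>
     (\<forall>V\<in>orth_mats n. \<forall>A\<in>sets \<mu>.
        emeasure \<mu> ((\<lambda>U. mat_mult n V U) -` A \<inter> space \<mu>) = emeasure \<mu> A)"

definition haar_On :: "nat \<Rightarrow> (nat \<Rightarrow> nat \<Rightarrow> real) measure" where
  "haar_On n = (THE \<mu>. is_haar_On n \<mu>)"

text \<open>I_n for the 2 x q matrix with rows a, b (lists of equal length q).\<close>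
definition I_n :: "nat \<Rightarrow> nat list \<Rightarrow> nat list \<Rightarrow> real" where
  "I_n n a b = (\<integral>U. (\<Prod>j<length a. U 0 j ^ (a ! j) * U 1 j ^ (b ! j)) \<partial>haar_On n)"

definition Phi_n :: "nat \<Rightarrow> nat list \<Rightarrow> nat list \<Rightarrow> real" where
  "Phi_n n a b =
     real (dfact (sum_list a + n - 2) * dfact (sum_list b + n - 2)) /
     (real (dfact (n - 2)) ^ 2 * (\<Prod>x\<leftarrow>a. real (dfact x)) * (\<Prod>x\<leftarrow>b. real (dfact x)))
     * I_n n a b"

end

theory Submission
  imports Defs
begin

text \<open>The Haar measure is unique, and invariant under transposition, because integrating the indicator of
  \<open>V\<^sup>T U \<in> A\<close> over two left-invariant probability measures can be done in either order. It exists as the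
  law of the Gram--Schmidt orthonormalisation of the columns of a random matrix that is distributed
  uniformly on the regular part of a ball: Gram--Schmidt commutes with left multiplication by
  orthogonal matrices, and Lebesgue measure is invariant under it. Being left and transposition invariant,
  the Haar measure is invariant under rotations of two columns. This expresses a mixed moment of the two entries
  of the first row in these columns by a pure moment of one of them, where the quotient of the double
  factorials is exactly the one built into \<open>\<Phi>\<^sub>n\<close>. The columns of \<open>c\<close> are merged two at a time.\<close>

section \<open>Orthogonal matrices\<close>

text \<open>\<open>haar_On\<close> is a definite description, so nothing can be said about its
  integrals until existence and uniqueness are both available; much of the development serves that.
  The defining invariance is under left multiplication, which mixes rows, whereas merging has to mix
  columns; transposition bridges the two. The ball has two roles. It gives the normalising volume a
  finite bound, and it replaces determinants: a surjective linear map scales volume by a constant,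
  and a set of finite positive volume that equals its own preimage forces this constant to be 1.
  Merging depends on the zeros below \<open>c\<close>: in these columns the integrand involves only
  the first row, so a rotation of two of them acts on a single power of a linear form, while the
  remaining columns form a weight that the rotation fixes. Only ratios of moments are compared, with
  that weight left arbitrary.\<close>

text \<open>\<open>P = U\<^sup>T U\<close> satisfies \<open>tr P = tr P\<^sup>2 = n\<close>, so \<open>I - P\<close> has Frobenius norm \<open>0\<close>.\<close>

lemma row_orthonormal_imp_col_orthonormal:
  fixes U :: "nat \<Rightarrow> nat \<Rightarrow> real"
  assumes U: "\<And>i k. i < n \<Longrightarrow> k < n \<Longrightarrow> (\<Sum>j<n. U i j * U k j) = (if i = k then 1 else 0)"
    and "j < n" "l < n"
  shows "(\<Sum>i<n. U i j * U i l) = (if j = l then 1 else 0)"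
proof -
  define P where "P j l = (\<Sum>i<n. U i j * U i l)" for j l
  define d :: "nat \<Rightarrow> nat \<Rightarrow> real" where "d j l = (if j = l then 1 else 0)" for j l
  have trP: "(\<Sum>j<n. P j j) = n"
  proof -
    have "(\<Sum>j<n. P j j) = (\<Sum>i<n. \<Sum>j<n. U i j * U i j)"
      unfolding P_def by (rule sum.swap)
    also have "\<dots> = n" by (simp add: U)
    finally show ?thesis .
  qed
  \<comment> \<open>Reordering the four sums turns the squared Frobenius norm of U^T U into that of
    U U^T, which is the identity by hypothesis.\<close>
  have PP: "(\<Sum>j<n. \<Sum>l<n. P j l * P j l) = n"
  proof -
    have "(\<Sum>j<n. \<Sum>l<n. P j l * P j l)
        = (\<Sum>j<n. \<Sum>l<n. \<Sum>i<n. \<Sum>k<n. (U i j * U k j) * (U i l * U k l))"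
      unfolding P_def sum_product by (intro sum.cong refl) (simp add: mult_ac)
    also have "\<dots> = (\<Sum>j<n. \<Sum>i<n. \<Sum>l<n. \<Sum>k<n. (U i j * U k j) * (U i l * U k l))"
      by (intro sum.cong refl sum.swap)
    also have "\<dots> = (\<Sum>i<n. \<Sum>j<n. \<Sum>l<n. \<Sum>k<n. (U i j * U k j) * (U i l * U k l))"
      by (rule sum.swap)
    also have "\<dots> = (\<Sum>i<n. \<Sum>j<n. \<Sum>k<n. \<Sum>l<n. (U i j * U k j) * (U i l * U k l))"
      by (intro sum.cong refl sum.swap)
    also have "\<dots> = (\<Sum>i<n. \<Sum>k<n. \<Sum>j<n. \<Sum>l<n. (U i j * U k j) * (U i l * U k l))"
      by (intro sum.cong refl sum.swap)
    also have "\<dots> = (\<Sum>i<n. \<Sum>k<n. (\<Sum>j<n. U i j * U k j) * (\<Sum>l<n. U i l * U k l))"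
      by (simp add: sum_product)
    also have "\<dots> = (\<Sum>i<n. \<Sum>k<n. if i = k then 1 else 0)"
      by (intro sum.cong refl) (simp add: U)
    also have "\<dots> = n" by simp
    finally show ?thesis .
  qed
  have "(\<Sum>j<n. \<Sum>l<n. (d j l - P j l)\<^sup>2)
      = (\<Sum>j<n. \<Sum>l<n. d j l) - 2 * (\<Sum>j<n. \<Sum>l<n. d j l * P j l) + (\<Sum>j<n. \<Sum>l<n. P j l * P j l)"
    unfolding sum_distrib_left sum_subtractf[symmetric] sum.distrib[symmetric]
    by (intro sum.cong refl) (auto simp: d_def power2_eq_square algebra_simps)
  also have "(\<Sum>j<n. \<Sum>l<n. d j l) = n" by (simp add: d_def)
  also have "(\<Sum>j<n. \<Sum>l<n. d j l * P j l) = n"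
    unfolding trP[symmetric] by (intro sum.cong refl) (simp add: d_def if_distrib[of "\<lambda>x. x * _"] cong: if_cong)
  finally have 0: "(\<Sum>j<n. \<Sum>l<n. (d j l - P j l)\<^sup>2) = 0" by (simp add: PP)
  then have "(\<Sum>l<n. (d j l - P j l)\<^sup>2) = 0"
    using \<open>j < n\<close> by (subst (asm) sum_nonneg_eq_0_iff) (auto intro: sum_nonneg)
  then have "(d j l - P j l)\<^sup>2 = 0"
    using \<open>l < n\<close> by (subst (asm) sum_nonneg_eq_0_iff) auto
  then show ?thesis by (simp add: d_def P_def)
qed

lemma orth_matsD:
  assumes "U \<in> orth_mats n"
  shows "n \<le> i \<or> n \<le> j \<Longrightarrow> U i j = 0"
    and "i < n \<Longrightarrow> k < n \<Longrightarrow> (\<Sum>j<n. U i j * U k j) = (if i = k then 1 else 0)"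
    and "j < n \<Longrightarrow> l < n \<Longrightarrow> (\<Sum>i<n. U i j * U i l) = (if j = l then 1 else 0)"
proof -
  show *: "i < n \<Longrightarrow> k < n \<Longrightarrow> (\<Sum>j<n. U i j * U k j) = (if i = k then 1 else 0)" for i k
    using assms by (auto simp: orth_mats_def)
  show "n \<le> i \<or> n \<le> j \<Longrightarrow> U i j = 0"
    using assms by (auto simp: orth_mats_def)
  show "j < n \<Longrightarrow> l < n \<Longrightarrow> (\<Sum>i<n. U i j * U i l) = (if j = l then 1 else 0)"
    by (rule row_orthonormal_imp_col_orthonormal) (rule *)
qed

text \<open>The row statement applied to the transpose. Products, Gram-Schmidt matrices and plane
  rotations are all naturally checked by columns.\<close>

lemma col_orthonormal_imp_orth_mats:
  assumes "\<And>i j. n \<le> i \<or> n \<le> j \<Longrightarrow> U i j = 0"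
    and "\<And>j l. j < n \<Longrightarrow> l < n \<Longrightarrow> (\<Sum>i<n. U i j * U i l) = (if j = l then 1 else 0)"
  shows "U \<in> orth_mats n"
  using row_orthonormal_imp_col_orthonormal[of n "\<lambda>i j. U j i"] assms
  by (auto simp: orth_mats_def)

definition mat_transpose :: "(nat \<Rightarrow> nat \<Rightarrow> real) \<Rightarrow> nat \<Rightarrow> nat \<Rightarrow> real" where
  "mat_transpose U = (\<lambda>i j. U j i)"

lemma mat_transpose_transpose [simp]: "mat_transpose (mat_transpose U) = U"
  by (simp add: mat_transpose_def)

lemma mat_transpose_orth [simp, intro]:
  assumes "U \<in> orth_mats n" shows "mat_transpose U \<in> orth_mats n"
  using orth_matsD[OF assms] by (intro col_orthonormal_imp_orth_mats) (auto simp: mat_transpose_def)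

lemma mat_transpose_mult:
  "mat_transpose (mat_mult n A B) = mat_mult n (mat_transpose B) (mat_transpose A)"
  by (auto simp: mat_transpose_def mat_mult_def fun_eq_iff mult.commute)

text \<open>Summing over the row index first leaves the inner products of the columns of
  \<open>V\<close>, that is V^T V = I.\<close>

lemma mat_mult_cols_inner:
  assumes V: "V \<in> orth_mats n"
  shows "(\<Sum>i<n. (\<Sum>k<n. V i k * x k) * (\<Sum>k<n. V i k * y k)) = (\<Sum>k<n. x k * y k)"
proof -
  have "(\<Sum>i<n. (\<Sum>k<n. V i k * x k) * (\<Sum>k<n. V i k * y k))
      = (\<Sum>i<n. \<Sum>k<n. \<Sum>l<n. V i k * V i l * (x k * y l))"
    unfolding sum_product by (intro sum.cong refl) (simp add: mult_ac)
  also have "\<dots> = (\<Sum>k<n. \<Sum>i<n. \<Sum>l<n. V i k * V i l * (x k * y l))"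
    by (rule sum.swap)
  also have "\<dots> = (\<Sum>k<n. \<Sum>l<n. \<Sum>i<n. V i k * V i l * (x k * y l))"
    by (intro sum.cong refl sum.swap)
  also have "\<dots> = (\<Sum>k<n. \<Sum>l<n. (if k = l then 1 else 0) * (x k * y l))"
    by (intro sum.cong refl) (simp add: sum_distrib_right[symmetric] orth_matsD(3)[OF V])
  also have "\<dots> = (\<Sum>k<n. x k * y k)"
    by (simp add: if_distrib[of "\<lambda>x. x * _"] cong: if_cong)
  finally show ?thesis .
qed

lemma mat_mult_orth [simp, intro]:
  assumes V: "V \<in> orth_mats n" and U: "U \<in> orth_mats n" shows "mat_mult n V U \<in> orth_mats n"
proof (rule col_orthonormal_imp_orth_mats)
  fix j l assume jl: "j < n" "l < n"
  then have "(\<Sum>i<n. mat_mult n V U i j * mat_mult n V U i l)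
      = (\<Sum>i<n. (\<Sum>k<n. V i k * U k j) * (\<Sum>k<n. V i k * U k l))"
    by (intro sum.cong refl) (simp add: mat_mult_def)
  also have "\<dots> = (\<Sum>k<n. U k j * U k l)"
    by (rule mat_mult_cols_inner[OF V])
  also have "\<dots> = (if j = l then 1 else 0)"
    by (rule orth_matsD(3)[OF U jl])
  finally show "(\<Sum>i<n. mat_mult n V U i j * mat_mult n V U i l) = (if j = l then 1 else 0)" .
qed (auto simp: mat_mult_def)

text \<open>This bound makes every monomial in the entries integrable against the Haar
  measure.\<close>

lemma orth_mats_entry_le_1:
  assumes "U \<in> orth_mats n" shows "\<bar>U i j\<bar> \<le> 1"
proof (cases "i < n \<and> j < n")
  case True
  then have "(U i j)\<^sup>2 \<le> (\<Sum>j<n. U i j * U i j)"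
    unfolding power2_eq_square by (intro member_le_sum) auto
  also have "\<dots> = 1" using True orth_matsD(2)[OF assms, of i i] by simp
  finally show ?thesis by (simp add: abs_square_le_1)
qed (use orth_matsD(1)[OF assms] in auto)

section \<open>Uniqueness of the Haar measure\<close>

lemma borel_measurable_mat_entry [measurable]:
  "(\<lambda>U::nat \<Rightarrow> nat \<Rightarrow> real. U i j) \<in> borel_measurable borel"
  by (intro measurable_product_then_coordinatewise[where f = "\<lambda>U. U i"]
      measurable_product_then_coordinatewise[where f = "\<lambda>U. U"]) simp

lemma borel_measurable_matI:
  fixes f :: "'a \<Rightarrow> nat \<Rightarrow> nat \<Rightarrow> real"
  assumes "\<And>i j. (\<lambda>x. f x i j) \<in> borel_measurable M"
  shows "f \<in> borel_measurable M"
  by (intro measurable_coordinatewise_then_product assms)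

definition orth_borel :: "nat \<Rightarrow> (nat \<Rightarrow> nat \<Rightarrow> real) measure" where
  "orth_borel n = restrict_space borel (orth_mats n)"

lemma space_orth_borel [simp]: "space (orth_borel n) = orth_mats n"
  by (simp add: orth_borel_def space_restrict_space)

lemma measurable_orth_borelI:
  assumes "\<And>x. x \<in> space M \<Longrightarrow> f x \<in> orth_mats n"
    and "\<And>i j. (\<lambda>x. f x i j) \<in> borel_measurable M"
  shows "f \<in> measurable M (orth_borel n)"
  unfolding orth_borel_def
  by (rule measurable_restrict_space2) (use assms in \<open>auto intro: borel_measurable_matI\<close>)

lemma measurable_orth_borel_entry [measurable]:
  "(\<lambda>U. U i j) \<in> borel_measurable (orth_borel n)"
  unfolding orth_borel_def by (rule measurable_restrict_space1) simp

lemma measurable_orth_borel_entry2 [measurable (raw)]: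
  assumes "f \<in> measurable M (orth_borel n)"
  shows "(\<lambda>x. f x i j) \<in> borel_measurable M"
  using measurable_compose[OF assms measurable_orth_borel_entry] .

lemma measurable_mat_mult [measurable (raw)]:
  assumes [measurable]: "f \<in> measurable M (orth_borel n)" "g \<in> measurable M (orth_borel n)"
  shows "(\<lambda>x. mat_mult n (f x) (g x)) \<in> measurable M (orth_borel n)"
proof (rule measurable_orth_borelI)
  show "x \<in> space M \<Longrightarrow> mat_mult n (f x) (g x) \<in> orth_mats n" for x
    using measurable_space[OF assms(1)] measurable_space[OF assms(2)] by auto
  show "(\<lambda>x. mat_mult n (f x) (g x) i j) \<in> borel_measurable M" for i j
    unfolding mat_mult_def by measurable
qed

lemma measurable_mat_transpose [measurable (raw)]:
  assumes [measurable]: "f \<in> measurable M (orth_borel n)"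
  shows "(\<lambda>x. mat_transpose (f x)) \<in> measurable M (orth_borel n)"
proof (rule measurable_orth_borelI)
  show "x \<in> space M \<Longrightarrow> mat_transpose (f x) \<in> orth_mats n" for x
    using measurable_space[OF assms(1)] by auto
  show "(\<lambda>x. mat_transpose (f x) i j) \<in> borel_measurable M" for i j
    unfolding mat_transpose_def by measurable
qed

lemma sets_mat_mult_vimage:
  assumes "V \<in> orth_mats n" and A: "A \<in> sets (orth_borel n)"
  shows "{U \<in> orth_mats n. mat_mult n V U \<in> A} \<in> sets (orth_borel n)"
proof -
  have "mat_mult n V \<in> measurable (orth_borel n) (orth_borel n)"
    using assms by (intro measurable_mat_mult measurable_const) auto
  from measurable_sets[OF this A] show ?thesis
    by (simp add: vimage_def Int_def conj_commute)
qed

lemma is_haar_OnD: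
  assumes "is_haar_On n \<mu>"
  shows "prob_space \<mu>" and "sets \<mu> = sets (orth_borel n)" and "space \<mu> = orth_mats n"
    and "V \<in> orth_mats n \<Longrightarrow> A \<in> sets (orth_borel n) \<Longrightarrow>
      emeasure \<mu> {U \<in> orth_mats n. mat_mult n V U \<in> A} = emeasure \<mu> A"
proof -
  show "prob_space \<mu>" and s: "sets \<mu> = sets (orth_borel n)"
    using assms by (auto simp: is_haar_On_def orth_borel_def)
  show sp: "space \<mu> = orth_mats n"
    using sets_eq_imp_space_eq[OF s] by simp
  show "V \<in> orth_mats n \<Longrightarrow> A \<in> sets (orth_borel n) \<Longrightarrow>
      emeasure \<mu> {U \<in> orth_mats n. mat_mult n V U \<in> A} = emeasure \<mu> A"
    using assms s sp unfolding is_haar_On_def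
    by (auto simp: vimage_def Int_def conj_commute)
qed

text \<open>Keeping two measures serves two purposes: a common right-hand side identifies \<mu> with
  \<nu>, and the case \<mu> = \<nu> is invariance under transposition.\<close>

lemma haar_transpose:
  assumes \<mu>: "is_haar_On n \<mu>" and \<nu>: "is_haar_On n \<nu>" and A: "A \<in> sets (orth_borel n)"
  shows "emeasure \<mu> A = emeasure \<nu> {U \<in> orth_mats n. mat_transpose U \<in> A}"
proof -
  interpret M: prob_space \<mu> by (rule is_haar_OnD(1)[OF \<mu>])
  interpret N: prob_space \<nu> by (rule is_haar_OnD(1)[OF \<nu>])
  interpret pair_sigma_finite \<nu> \<mu> ..
  note [measurable_cong] = is_haar_OnD(2)[OF \<mu>] is_haar_OnD(2)[OF \<nu>]
  note [measurable] = A
  let ?A' = "{U \<in> orth_mats n. mat_transpose U \<in> A}"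
  have A': "?A' \<in> sets (orth_borel n)"
  proof -
    have "{U \<in> space (orth_borel n). mat_transpose U \<in> A} \<in> sets (orth_borel n)"
      by measurable
    then show ?thesis by simp
  qed
  define f :: "_ \<Rightarrow> ennreal" where "f = (\<lambda>(V, U). indicator A (mat_mult n (mat_transpose V) U))"
  have [measurable]: "f \<in> borel_measurable (\<nu> \<Otimes>\<^sub>M \<mu>)"
    unfolding f_def by measurable
  have 1: "(\<integral>\<^sup>+U. f (V, U) \<partial>\<mu>) = emeasure \<mu> A" if "V \<in> orth_mats n" for V
  proof -
    have "(\<integral>\<^sup>+U. f (V, U) \<partial>\<mu>) = (\<integral>\<^sup>+U. indicator {U \<in> orth_mats n. mat_mult n (mat_transpose V) U \<in> A} U \<partial>\<mu>)"
      by (intro nn_integral_cong) (auto simp: f_def is_haar_OnD(3)[OF \<mu>] indicator_def)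
    also have "\<dots> = emeasure \<mu> {U \<in> orth_mats n. mat_mult n (mat_transpose V) U \<in> A}"
      by (intro nn_integral_indicator) (use sets_mat_mult_vimage[OF mat_transpose_orth[OF that] A] in \<open>simp add: is_haar_OnD(2)[OF \<mu>]\<close>)
    also have "\<dots> = emeasure \<mu> A"
      by (rule is_haar_OnD(4)[OF \<mu> _ A]) (use that in auto)
    finally show ?thesis .
  qed
  \<comment> \<open>Since V^T U is the transpose of U^T V, for fixed \<open>U\<close> the condition
    says that U^T V lies in \<open>?A'\<close>, and left invariance of \<nu> applies.\<close>
  have 2: "(\<integral>\<^sup>+V. f (V, U) \<partial>\<nu>) = emeasure \<nu> ?A'" if U: "U \<in> orth_mats n" for U
  proof -
    have "(\<integral>\<^sup>+V. f (V, U) \<partial>\<nu>) = (\<integral>\<^sup>+V. indicator {V \<in> orth_mats n. mat_mult n (mat_transpose U) V \<in> ?A'} V \<partial>\<nu>)"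
      using U by (intro nn_integral_cong)
        (auto simp: f_def is_haar_OnD(3)[OF \<nu>] indicator_def mat_transpose_mult)
    also have "\<dots> = emeasure \<nu> {V \<in> orth_mats n. mat_mult n (mat_transpose U) V \<in> ?A'}"
      by (intro nn_integral_indicator) (use sets_mat_mult_vimage[OF mat_transpose_orth[OF that] A'] in \<open>simp add: is_haar_OnD(2)[OF \<nu>]\<close>)
    also have "\<dots> = emeasure \<nu> ?A'"
      by (rule is_haar_OnD(4)[OF \<nu> _ A']) (use that in auto)
    finally show ?thesis .
  qed
  have "emeasure \<mu> A = (\<integral>\<^sup>+V. emeasure \<mu> A \<partial>\<nu>)"
    by (simp add: N.emeasure_space_1)
  also have "\<dots> = (\<integral>\<^sup>+V. \<integral>\<^sup>+U. f (V, U) \<partial>\<mu> \<partial>\<nu>)"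
    by (intro nn_integral_cong) (simp add: 1 is_haar_OnD(3)[OF \<nu>])
  also have "\<dots> = (\<integral>\<^sup>+U. \<integral>\<^sup>+V. f (V, U) \<partial>\<nu> \<partial>\<mu>)"
    by (rule Fubini'[symmetric]) simp
  also have "\<dots> = (\<integral>\<^sup>+U. emeasure \<nu> ?A' \<partial>\<mu>)"
    by (intro nn_integral_cong) (simp add: 2 is_haar_OnD(3)[OF \<mu>])
  also have "\<dots> = emeasure \<nu> ?A'"
    by (simp add: M.emeasure_space_1)
  finally show ?thesis .
qed

lemma haar_unique:
  assumes \<mu>: "is_haar_On n \<mu>" and \<nu>: "is_haar_On n \<nu>"
  shows "\<mu> = \<nu>"
proof (rule measure_eqI)
  show "sets \<mu> = sets \<nu>" using is_haar_OnD(2)[OF \<mu>] is_haar_OnD(2)[OF \<nu>] by simp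
  fix A assume "A \<in> sets \<mu>"
  then have A: "A \<in> sets (orth_borel n)" by (simp add: is_haar_OnD(2)[OF \<mu>])
  show "emeasure \<mu> A = emeasure \<nu> A"
    using haar_transpose[OF \<mu> \<nu> A] haar_transpose[OF \<nu> \<nu> A] by simp
qed

section \<open>Linear invariance of the Lebesgue product measure\<close>

abbreviation lborel_fun :: "'i set \<Rightarrow> ('i \<Rightarrow> real) measure" where
  "lborel_fun I \<equiv> PiM I (\<lambda>_. lborel)"

text \<open>Points of a product space are extensional, with a fixed value outside \<open>I\<close>;
  restricting the pointwise operations to \<open>I\<close> keeps their results in the space.\<close>

definition fun_plus :: "'i set \<Rightarrow> ('i \<Rightarrow> real) \<Rightarrow> ('i \<Rightarrow> real) \<Rightarrow> 'i \<Rightarrow> real" where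
  "fun_plus I x y = (\<lambda>i\<in>I. x i + y i)"

definition fun_minus :: "'i set \<Rightarrow> ('i \<Rightarrow> real) \<Rightarrow> ('i \<Rightarrow> real) \<Rightarrow> 'i \<Rightarrow> real" where
  "fun_minus I x y = (\<lambda>i\<in>I. x i - y i)"

lemma measurable_fun_plus [measurable (raw)]:
  assumes [measurable]: "f \<in> measurable M (lborel_fun I)" "g \<in> measurable M (lborel_fun I)"
  shows "(\<lambda>x. fun_plus I (f x) (g x)) \<in> measurable M (lborel_fun I)"
  unfolding fun_plus_def
proof (rule measurable_restrict)
  fix i assume "i \<in> I"
  then have [measurable]: "(\<lambda>x. f x i) \<in> borel_measurable M" "(\<lambda>x. g x i) \<in> borel_measurable M"
    using measurable_compose[OF assms(1) measurable_component_singleton]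
      measurable_compose[OF assms(2) measurable_component_singleton] by auto
  show "(\<lambda>x. f x i + g x i) \<in> measurable M lborel" by simp
qed

lemma measurable_fun_minus [measurable (raw)]:
  assumes [measurable]: "f \<in> measurable M (lborel_fun I)" "g \<in> measurable M (lborel_fun I)"
  shows "(\<lambda>x. fun_minus I (f x) (g x)) \<in> measurable M (lborel_fun I)"
  unfolding fun_minus_def
proof (rule measurable_restrict)
  fix i assume "i \<in> I"
  then have [measurable]: "(\<lambda>x. f x i) \<in> borel_measurable M" "(\<lambda>x. g x i) \<in> borel_measurable M"
    using measurable_compose[OF assms(1) measurable_component_singleton]
      measurable_compose[OF assms(2) measurable_component_singleton] by auto
  show "(\<lambda>x. f x i - g x i) \<in> measurable M lborel" by simp
qed

text \<open>A product measure is determined by its values on boxes, and the preimage of a box is a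
  box with translated sides, so one-dimensional translation invariance suffices.\<close>

lemma distr_lborel_fun_plus:
  fixes I :: "'i set"
  assumes I: "finite I" and t: "t \<in> space (lborel_fun I)"
  shows "distr (lborel_fun I) (lborel_fun I) (\<lambda>x. fun_plus I x t) = lborel_fun I"
proof -
  interpret product_sigma_finite "\<lambda>_::'i. lborel :: real measure" ..
  have [measurable]: "(\<lambda>x. fun_plus I x t) \<in> measurable (lborel_fun I) (lborel_fun I)"
    using t by (intro measurable_fun_plus) auto
  show ?thesis
  proof (rule PiM_eqI[OF I])
    fix A :: "'i \<Rightarrow> real set" assume A: "\<And>i. i \<in> I \<Longrightarrow> A i \<in> sets lborel"
    have tr: "(\<lambda>x. x + t i) -` A i \<in> sets lborel \<and> emeasure lborel ((\<lambda>x. x + t i) -` A i) = emeasure lborel (A i)"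
      if "i \<in> I" for i
    proof -
      have Ai: "A i \<in> sets borel" using A[OF that] by simp
      have m: "(\<lambda>x. x + t i) \<in> borel_measurable borel" by measurable
      have "emeasure lborel (A i) = emeasure (distr lborel borel ((+) (t i))) (A i)"
        by (simp add: lborel_distr_plus)
      also have "\<dots> = emeasure lborel ((\<lambda>x. x + t i) -` A i)"
        by (subst emeasure_distr) (use Ai in \<open>auto simp: add.commute vimage_def\<close>)
      finally show ?thesis using measurable_sets[OF m Ai] by simp
    qed
    have "emeasure (distr (lborel_fun I) (lborel_fun I) (\<lambda>x. fun_plus I x t)) (PiE I A)
        = emeasure (lborel_fun I) ((\<lambda>x. fun_plus I x t) -` PiE I A \<inter> space (lborel_fun I))"
      by (intro emeasure_distr sets_PiM_I_finite I A) auto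
    also have "(\<lambda>x. fun_plus I x t) -` PiE I A \<inter> space (lborel_fun I) = PiE I (\<lambda>i. (\<lambda>x. x + t i) -` A i)"
      by (auto simp: space_PiM fun_plus_def PiE_iff)
    also have "emeasure (lborel_fun I) \<dots> = (\<Prod>i\<in>I. emeasure lborel ((\<lambda>x. x + t i) -` A i))"
      by (rule emeasure_PiM) (use I tr in auto)
    also have "\<dots> = (\<Prod>i\<in>I. emeasure lborel (A i))"
      by (intro prod.cong refl) (use tr in auto)
    finally show "emeasure (distr (lborel_fun I) (lborel_fun I) (\<lambda>x. fun_plus I x t)) (PiE I A)
        = (\<Prod>i\<in>I. emeasure lborel (A i))" .
  qed simp
qed

lemma nn_integral_lborel_fun_plus:
  assumes I: "finite I" and t: "t \<in> space (lborel_fun I)"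
    and [measurable]: "f \<in> borel_measurable (lborel_fun I)"
  shows "(\<integral>\<^sup>+x. f (fun_plus I x t) \<partial>lborel_fun I) = (\<integral>\<^sup>+x. f x \<partial>lborel_fun I)"
proof -
  have [measurable]: "(\<lambda>x. fun_plus I x t) \<in> measurable (lborel_fun I) (lborel_fun I)"
    using t by (intro measurable_fun_plus) auto
  have "(\<integral>\<^sup>+x. f x \<partial>lborel_fun I) = (\<integral>\<^sup>+x. f x \<partial>distr (lborel_fun I) (lborel_fun I) (\<lambda>x. fun_plus I x t))"
    by (simp add: distr_lborel_fun_plus[OF I t])
  also have "\<dots> = (\<integral>\<^sup>+x. f (fun_plus I x t) \<partial>lborel_fun I)"
    by (rule nn_integral_distr) auto
  finally show ?thesis ..
qed

text \<open>Both \<open>\<lambda>\<close> and its image under \<open>T\<close> are translation invariant, so Fubini gives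
  \<open>\<lambda>(A) \<lambda>(B) = \<lambda>(T\<^sup>-\<^sup>1 A) \<lambda>(B)\<close> as soon as \<open>B\<close> is symmetric and \<open>T\<close>-invariant.\<close>

lemma emeasure_lborel_fun_linear:
  fixes I :: "'i set" and T :: "('i \<Rightarrow> real) \<Rightarrow> 'i \<Rightarrow> real"
  assumes I: "finite I" and T [measurable]: "T \<in> measurable (lborel_fun I) (lborel_fun I)"
    and add: "\<And>x y. x \<in> space (lborel_fun I) \<Longrightarrow> y \<in> space (lborel_fun I) \<Longrightarrow>
      T (fun_plus I x y) = fun_plus I (T x) (T y)"
    and surj: "\<And>x. x \<in> space (lborel_fun I) \<Longrightarrow> \<exists>y\<in>space (lborel_fun I). T y = x"
    and B [measurable]: "B \<in> sets (lborel_fun I)"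
    and sym: "\<And>x y. x \<in> space (lborel_fun I) \<Longrightarrow> y \<in> space (lborel_fun I) \<Longrightarrow>
      fun_minus I x y \<in> B \<longleftrightarrow> fun_minus I y x \<in> B"
    and inv: "\<And>x. x \<in> space (lborel_fun I) \<Longrightarrow> T x \<in> B \<longleftrightarrow> x \<in> B"
    and B_pos: "emeasure (lborel_fun I) B > 0" and B_fin: "emeasure (lborel_fun I) B < \<infinity>"
    and A [measurable]: "A \<in> sets (lborel_fun I)"
  shows "emeasure (lborel_fun I) {x \<in> space (lborel_fun I). T x \<in> A} = emeasure (lborel_fun I) A"
proof -
  interpret product_sigma_finite "\<lambda>_::'i. lborel :: real measure" ..
  let ?L = "lborel_fun I"
  interpret L: sigma_finite_measure ?L by (rule sigma_finite[OF I])
  interpret pair_sigma_finite ?L ?L ..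
  define f :: "('i \<Rightarrow> real) \<Rightarrow> ennreal" where "f = indicator A"
  define g :: "('i \<Rightarrow> real) \<Rightarrow> ennreal" where "g = indicator B"
  have [measurable]: "f \<in> borel_measurable ?L" "g \<in> borel_measurable ?L"
    unfolding f_def g_def by measurable
  have Tsp: "T x \<in> space ?L" if "x \<in> space ?L" for x
    using measurable_space[OF T that] .
  have plus_minus: "fun_minus I (fun_plus I x y) y = x" "fun_minus I (fun_plus I y x) y = x"
    if "x \<in> space ?L" "y \<in> space ?L" for x y
    using that by (auto simp: fun_plus_def fun_minus_def space_PiM fun_eq_iff PiE_iff extensional_def)
  have plus_commute: "fun_plus I x y = fun_plus I y x" for x y
    by (auto simp: fun_plus_def fun_eq_iff)
  have gint: "(\<integral>\<^sup>+x. g x \<partial>?L) = emeasure ?L B" by (simp add: g_def)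
  have gT: "(\<integral>\<^sup>+y. g (T y) \<partial>?L) = emeasure ?L B"
    unfolding gint[symmetric] by (intro nn_integral_cong) (auto simp: g_def inv indicator_def)
  have fT: "(\<integral>\<^sup>+y. f (T y) \<partial>?L) = emeasure ?L {x \<in> space ?L. T x \<in> A}"
  proof -
    have "(\<integral>\<^sup>+y. f (T y) \<partial>?L) = (\<integral>\<^sup>+y. indicator {x \<in> space ?L. T x \<in> A} y \<partial>?L)"
      by (intro nn_integral_cong) (auto simp: f_def indicator_def)
    then show ?thesis by simp
  qed
  \<comment> \<open>The weight \<open>g (T y)\<close> still integrates to the measure of
    \<open>B\<close> because \<open>B\<close> is \<open>T\<close>-invariant; the inner integral may
    then be translated by \<open>T y\<close>.\<close>
  have "emeasure ?L A * emeasure ?L B = (\<integral>\<^sup>+y. (\<integral>\<^sup>+x. f x \<partial>?L) * g (T y) \<partial>?L)"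
    by (simp add: nn_integral_cmult gT) (simp add: f_def)
  also have "\<dots> = (\<integral>\<^sup>+y. (\<integral>\<^sup>+x. f (fun_plus I x (T y)) \<partial>?L) * g (T y) \<partial>?L)"
    by (intro nn_integral_cong) (simp add: nn_integral_lborel_fun_plus[OF I Tsp])
  also have "\<dots> = (\<integral>\<^sup>+y. (\<integral>\<^sup>+x. f (fun_plus I x (T y)) * g (T y) \<partial>?L) \<partial>?L)"
  proof (rule nn_integral_cong)
    fix y assume "y \<in> space ?L"
    note [measurable] = Tsp[OF this]
    show "(\<integral>\<^sup>+x. f (fun_plus I x (T y)) \<partial>?L) * g (T y) = (\<integral>\<^sup>+x. f (fun_plus I x (T y)) * g (T y) \<partial>?L)"
      by (rule nn_integral_multc[symmetric]) measurable
  qed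
  also have "\<dots> = (\<integral>\<^sup>+x. (\<integral>\<^sup>+y. f (fun_plus I x (T y)) * g (T y) \<partial>?L) \<partial>?L)"
    by (rule Fubini') measurable
  also have "\<dots> = (\<integral>\<^sup>+x. (\<integral>\<^sup>+y. f (T y) * g (fun_minus I (T y) x) \<partial>?L) \<partial>?L)"
  proof (rule nn_integral_cong)
    fix x assume x: "x \<in> space ?L"
    \<comment> \<open>Surjectivity enters here: a shift by \<open>x\<close> after \<open>T\<close>
      becomes a shift by \<open>s\<close> before it, which translation invariance absorbs.\<close>
    then obtain s where s: "s \<in> space ?L" "T s = x" using surj by blast
    have "(\<integral>\<^sup>+y. f (fun_plus I x (T y)) * g (T y) \<partial>?L)
        = (\<integral>\<^sup>+y. f (T (fun_plus I y s)) * g (fun_minus I (T (fun_plus I y s)) x) \<partial>?L)"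
      using s x by (intro nn_integral_cong) (simp add: add plus_minus plus_commute Tsp)
    also have "\<dots> = (\<integral>\<^sup>+y. f (T y) * g (fun_minus I (T y) x) \<partial>?L)"
      using x by (intro nn_integral_lborel_fun_plus[OF I s(1)]) measurable
    finally show "(\<integral>\<^sup>+y. f (fun_plus I x (T y)) * g (T y) \<partial>?L) = (\<integral>\<^sup>+y. f (T y) * g (fun_minus I (T y) x) \<partial>?L)" .
  qed
  also have "\<dots> = (\<integral>\<^sup>+y. (\<integral>\<^sup>+x. f (T y) * g (fun_minus I (T y) x) \<partial>?L) \<partial>?L)"
    by (rule Fubini') measurable
  also have "\<dots> = (\<integral>\<^sup>+y. f (T y) * emeasure ?L B \<partial>?L)"
  proof (rule nn_integral_cong)
    fix y assume y: "y \<in> space ?L"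
    note Ty = Tsp[OF y]
    have "(\<integral>\<^sup>+x. f (T y) * g (fun_minus I (T y) x) \<partial>?L) = f (T y) * (\<integral>\<^sup>+x. g (fun_minus I (T y) x) \<partial>?L)"
      using Ty by (intro nn_integral_cmult) measurable
    \<comment> \<open>Symmetry of \<open>B\<close> swaps the difference, so that the set to be
      measured becomes a translate of \<open>B\<close> itself rather than of its reflection.\<close>
    also have "(\<integral>\<^sup>+x. g (fun_minus I (T y) x) \<partial>?L) = (\<integral>\<^sup>+x. g (fun_minus I x (T y)) \<partial>?L)"
      using Ty by (intro nn_integral_cong) (simp add: g_def indicator_def sym)
    also have "\<dots> = (\<integral>\<^sup>+x. g (fun_minus I (fun_plus I x (T y)) (T y)) \<partial>?L)"
      using Ty by (intro nn_integral_lborel_fun_plus[OF I Ty, symmetric]) measurable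
    also have "\<dots> = (\<integral>\<^sup>+x. g x \<partial>?L)"
      using Ty by (intro nn_integral_cong) (simp add: plus_minus)
    finally show "(\<integral>\<^sup>+x. f (T y) * g (fun_minus I (T y) x) \<partial>?L) = f (T y) * emeasure ?L B"
      by (simp add: gint)
  qed
  also have "\<dots> = emeasure ?L {x \<in> space ?L. T x \<in> A} * emeasure ?L B"
    by (simp add: nn_integral_multc fT)
  finally show ?thesis
    using B_pos B_fin by (auto simp: mult.commute[of _ "emeasure ?L B"] ennreal_mult_cancel_left)
qed

lemma emeasure_lborel_fun_box:
  assumes "finite I"
  shows "emeasure (lborel_fun I) (PiE I (\<lambda>i. {l i..u i})) = (\<Prod>i\<in>I. ennreal (if l i \<le> u i then u i - l i else 0))"
proof -
  interpret product_sigma_finite "\<lambda>_. lborel :: real measure" ..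
  show ?thesis using assms by (subst emeasure_PiM) (auto simp: emeasure_lborel_Icc_eq intro!: prod.cong)
qed

section \<open>Gram--Schmidt\<close>

definition ip :: "nat \<Rightarrow> (nat \<Rightarrow> real) \<Rightarrow> (nat \<Rightarrow> real) \<Rightarrow> real" where
  "ip n u v = (\<Sum>i<n. u i * v i)"

lemma ip_self_eq_0_iff: "ip n u u = 0 \<longleftrightarrow> (\<forall>i<n. u i = 0)"
  unfolding ip_def by (subst sum_nonneg_eq_0_iff) auto

lemma ip_self_nonneg: "0 \<le> ip n u u"
  unfolding ip_def by (intro sum_nonneg) auto

lemma ip_commute: "ip n u v = ip n v u"
  unfolding ip_def by (simp add: mult.commute)

lemma ip_diff_scale_left: "ip n (\<lambda>i. u i - c * w i) v = ip n u v - c * ip n w v"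
  unfolding ip_def by (simp add: algebra_simps sum_subtractf sum_distrib_left)

text \<open>\<open>gs_resid n g k v\<close> is the component of \<open>v\<close> orthogonal to the first \<open>k\<close> vectors of \<open>g\<close>;
  since \<open>x / 0 = 0\<close>, vectors that depend linearly on their predecessors are skipped.\<close>

primrec gs_resid :: "nat \<Rightarrow> (nat \<Rightarrow> nat \<Rightarrow> real) \<Rightarrow> nat \<Rightarrow> (nat \<Rightarrow> real) \<Rightarrow> nat \<Rightarrow> real" where
  "gs_resid n g 0 v = v"
| "gs_resid n g (Suc k) v =
    (\<lambda>i. gs_resid n g k v i -
      ip n (gs_resid n g k v) (gs_resid n g k (g k)) /
      ip n (gs_resid n g k (g k)) (gs_resid n g k (g k)) * gs_resid n g k (g k) i)"

abbreviation gs_vec :: "nat \<Rightarrow> (nat \<Rightarrow> nat \<Rightarrow> real) \<Rightarrow> nat \<Rightarrow> nat \<Rightarrow> real" where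
  "gs_vec n g k \<equiv> gs_resid n g k (g k)"

text \<open>The induction needs arbitrary \<open>v\<close>, because each new residual combines the
  previous residuals of both \<open>v\<close> and \<open>g k\<close>.\<close>

lemma gs_resid_orthogonal: "j < k \<Longrightarrow> ip n (gs_resid n g k v) (gs_vec n g j) = 0"
proof (induction k arbitrary: v j)
  case (Suc k)
  show ?case
  proof (cases "j = k")
    case True
    show ?thesis
    proof (cases "ip n (gs_vec n g k) (gs_vec n g k) = 0")
      \<comment> \<open>A skipped vector has norm zero, so its first \<open>n\<close> entries vanish
        and it is orthogonal to everything.\<close>
      case 0: True
      then have "\<forall>i<n. gs_vec n g k i = 0" by (simp add: ip_self_eq_0_iff)
      then show ?thesis using True by (simp add: ip_def)
    next
      case False
      have "ip n (gs_resid n g (Suc k) v) (gs_vec n g k) = ip n (gs_resid n g k v) (gs_vec n g k) -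
          ip n (gs_resid n g k v) (gs_vec n g k) / ip n (gs_vec n g k) (gs_vec n g k) * ip n (gs_vec n g k) (gs_vec n g k)"
        by (simp add: ip_diff_scale_left del: times_divide_eq_left)
      then show ?thesis using False True by simp
    qed
  next
    case False
    with Suc.prems have "j < k" by simp
    then show ?thesis by (simp add: ip_diff_scale_left Suc.IH del: times_divide_eq_left)
  qed
qed simp

lemma gs_vec_orthogonal:
  assumes "j \<noteq> k" shows "ip n (gs_vec n g k) (gs_vec n g j) = 0"
  using assms gs_resid_orthogonal[of j k] gs_resid_orthogonal[of k j] ip_commute
  by (metis linorder_neqE_nat)

text \<open>It turns a vanishing residual into a linear relation between a vector and its
  predecessors.\<close>

lemma gs_resid_span: "\<exists>c. \<forall>i. gs_resid n g k v i = v i - (\<Sum>j<k. c j * g j i)"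
proof (induction k arbitrary: v)
  case (Suc k)
  obtain c where c: "\<And>i. gs_resid n g k v i = v i - (\<Sum>j<k. c j * g j i)" using Suc by blast
  obtain e where e: "\<And>i. gs_vec n g k i = g k i - (\<Sum>j<k. e j * g j i)" using Suc by blast
  define d where "d = ip n (gs_resid n g k v) (gs_vec n g k) / ip n (gs_vec n g k) (gs_vec n g k)"
  define c' where "c' j = (if j < k then c j - d * e j else d)" for j
  have "gs_resid n g (Suc k) v i = v i - (\<Sum>j<Suc k. c' j * g j i)" for i
  proof -
    have "gs_resid n g (Suc k) v i = gs_resid n g k v i - d * gs_vec n g k i"
      by (simp add: d_def)
    also have "\<dots> = v i - ((\<Sum>j<k. (c j - d * e j) * g j i) + d * g k i)"
      unfolding c e by (simp add: algebra_simps sum_subtractf sum_distrib_left)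
    also have "(\<Sum>j<k. (c j - d * e j) * g j i) = (\<Sum>j<k. c' j * g j i)"
      by (intro sum.cong) (auto simp: c'_def)
    finally show ?thesis by (simp add: c'_def)
  qed
  then show ?case by blast
qed simp

text \<open>At the index \<open>l\<close> of a largest coefficient, the diagonal term has size at
  least \<open>m\<close>, while the other n - 1 terms together reach at most m (n - 1) / n. This
  forces m = 0.\<close>

lemma diag_dominant_indep:
  fixes e :: "nat \<Rightarrow> real"
  assumes 0: "\<And>i. i < n \<Longrightarrow> (\<Sum>j<n. e j * G j i) = 0"
    and diag: "\<And>i. i < n \<Longrightarrow> 1 \<le> G i i"
    and off: "\<And>i j. i < n \<Longrightarrow> j < n \<Longrightarrow> i \<noteq> j \<Longrightarrow> \<bar>G j i\<bar> \<le> 1 / n"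
    and "k < n"
  shows "e k = 0"
proof -
  define m where "m = Max ((\<lambda>j. \<bar>e j\<bar>) ` {..<n})"
  have ne: "(\<lambda>j. \<bar>e j\<bar>) ` {..<n} \<noteq> {}" using \<open>k < n\<close> by auto
  have le: "\<bar>e j\<bar> \<le> m" if "j < n" for j using that by (auto simp: m_def)
  have "m \<in> (\<lambda>j. \<bar>e j\<bar>) ` {..<n}" unfolding m_def by (intro Max_in) (use ne in auto)
  then obtain l where l: "l < n" "m = \<bar>e l\<bar>" by auto
  have "(\<Sum>j<n. e j * G j l) = e l * G l l + (\<Sum>j\<in>{..<n}-{l}. e j * G j l)"
    using l by (subst sum.remove[of _ l]) auto
  then have "e l * G l l = - (\<Sum>j\<in>{..<n}-{l}. e j * G j l)" using 0[OF l(1)] by simp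
  then have "\<bar>e l * G l l\<bar> \<le> (\<Sum>j\<in>{..<n}-{l}. \<bar>e j * G j l\<bar>)" by (simp add: sum_abs)
  also have "\<dots> \<le> (\<Sum>j\<in>{..<n}-{l}. m * (1 / n))"
    unfolding abs_mult by (intro sum_mono mult_mono) (use l le off in auto)
  also have "\<dots> = m * ((real n - 1) / n)" using l by (simp add: of_nat_diff)
  finally have "\<bar>e l * G l l\<bar> \<le> m * ((real n - 1) / n)" .
  moreover have "m \<le> \<bar>e l * G l l\<bar>"
    using diag[OF l(1)] l mult_left_mono[of 1 "G l l" "\<bar>e l\<bar>"] by (simp add: abs_mult)
  ultimately have "m \<le> m * ((real n - 1) / n)" by simp
  then have "m * real n \<le> m * (real n - 1)" using \<open>k < n\<close> by (simp add: field_simps)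
  then have "m \<le> 0" by (simp add: algebra_simps)
  then show ?thesis using le[OF \<open>k < n\<close>] by simp
qed

lemma gs_vec_nonzero:
  assumes diag: "\<And>i. i < n \<Longrightarrow> 1 \<le> g i i"
    and off: "\<And>i j. i < n \<Longrightarrow> j < n \<Longrightarrow> i \<noteq> j \<Longrightarrow> \<bar>g j i\<bar> \<le> 1 / n"
    and k: "k < n"
  shows "ip n (gs_vec n g k) (gs_vec n g k) \<noteq> 0"
proof
  assume "ip n (gs_vec n g k) (gs_vec n g k) = 0"
  then have h: "gs_vec n g k i = 0" if "i < n" for i using that by (simp add: ip_self_eq_0_iff)
  obtain c where c: "\<And>i. gs_vec n g k i = g k i - (\<Sum>j<k. c j * g j i)"
    using gs_resid_span by blast
  \<comment> \<open>The relation behind a zero residual: coefficient 1 on vector \<open>k\<close>,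
    the negated span coefficients before it, and 0 after it.\<close>
  define e where "e j = (if j < k then - c j else if j = k then 1 else 0)" for j
  have "(\<Sum>j<n. e j * g j i) = 0" if "i < n" for i
  proof -
    have "(\<Sum>j<n. e j * g j i) = (\<Sum>j<Suc k. e j * g j i)"
      using k by (intro sum.mono_neutral_right) (auto simp: e_def)
    also have "\<dots> = (\<Sum>j<k. - c j * g j i) + g k i"
      unfolding sum.lessThan_Suc by (intro arg_cong2[where f = "(+)"] sum.cong) (auto simp: e_def)
    also have "\<dots> = gs_vec n g k i" by (simp add: c sum_negf)
    finally show ?thesis using h[OF that] by simp
  qed
  from diag_dominant_indep[OF this diag off k] show False by (simp add: e_def)
qed

section \<open>Equivariance of Gram-Schmidt\<close>

definition mat_vec :: "nat \<Rightarrow> (nat \<Rightarrow> nat \<Rightarrow> real) \<Rightarrow> (nat \<Rightarrow> real) \<Rightarrow> nat \<Rightarrow> real" where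
  "mat_vec n V v = (\<lambda>i. \<Sum>k<n. V i k * v k)"

lemma ip_mat_vec: "V \<in> orth_mats n \<Longrightarrow> ip n (mat_vec n V u) (mat_vec n V v) = ip n u v"
  unfolding ip_def mat_vec_def by (rule mat_mult_cols_inner)

text \<open>Gram-Schmidt consists of linear combinations whose coefficients are quotients of inner
  products, and \<open>V\<close> preserves the latter.\<close>

lemma gs_resid_mat_vec:
  assumes V: "V \<in> orth_mats n"
  shows "gs_resid n (\<lambda>k. mat_vec n V (g k)) m (mat_vec n V v) = mat_vec n V (gs_resid n g m v)"
proof (induction m arbitrary: v)
  case (Suc m)
  show ?case
    by (simp add: Suc ip_mat_vec[OF V])
      (simp add: mat_vec_def fun_eq_iff right_diff_distrib sum_subtractf sum_distrib_left sum_divide_distrib mult_ac)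
qed simp

section \<open>Existence of the Haar measure\<close>

abbreviation mat_idx :: "nat \<Rightarrow> (nat \<times> nat) set" where
  "mat_idx n \<equiv> {..<n} \<times> {..<n}"

text \<open>Indexing by pairs (row, column) makes matrix space one finite product of Lebesgue
  measures. Here the column comes first, so that a point becomes the family of vectors that
  Gram-Schmidt takes.\<close>

definition mat_cols :: "nat \<Rightarrow> (nat \<times> nat \<Rightarrow> real) \<Rightarrow> nat \<Rightarrow> nat \<Rightarrow> real" where
  "mat_cols n x = (\<lambda>k i. if i < n \<and> k < n then x (i, k) else 0)"

definition mat_act :: "nat \<Rightarrow> (nat \<Rightarrow> nat \<Rightarrow> real) \<Rightarrow> (nat \<times> nat \<Rightarrow> real) \<Rightarrow> nat \<times> nat \<Rightarrow> real" where
  "mat_act n V x = (\<lambda>p\<in>mat_idx n. \<Sum>k<n. V (fst p) k * x (k, snd p))"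

lemma mat_cols_act:
  assumes "V \<in> orth_mats n"
  shows "mat_cols n (mat_act n V x) = (\<lambda>k. mat_vec n V (mat_cols n x k))"
  using orth_matsD(1)[OF assms]
  by (auto simp: mat_cols_def mat_act_def mat_vec_def fun_eq_iff intro!: sum.cong)

definition gs_mat :: "nat \<Rightarrow> (nat \<times> nat \<Rightarrow> real) \<Rightarrow> nat \<Rightarrow> nat \<Rightarrow> real" where
  "gs_mat n x = (\<lambda>i k. if i < n \<and> k < n then
     gs_vec n (mat_cols n x) k i / sqrt (ip n (gs_vec n (mat_cols n x) k) (gs_vec n (mat_cols n x) k)) else 0)"

text \<open>Linear independence of the columns, phrased through the divisors of Gram-Schmidt: in
  this form it is visibly measurable and invariant under orthogonal maps.\<close>

definition gs_regular :: "nat \<Rightarrow> (nat \<times> nat \<Rightarrow> real) \<Rightarrow> bool" where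
  "gs_regular n x \<longleftrightarrow> (\<forall>k<n. ip n (gs_vec n (mat_cols n x) k) (gs_vec n (mat_cols n x) k) \<noteq> 0)"

lemma gs_mat_orth:
  assumes "gs_regular n x" shows "gs_mat n x \<in> orth_mats n"
proof (rule col_orthonormal_imp_orth_mats)
  let ?h = "gs_vec n (mat_cols n x)"
  fix j l assume jl: "j < n" "l < n"
  have "(\<Sum>i<n. gs_mat n x i j * gs_mat n x i l) = ip n (?h j) (?h l) / (sqrt (ip n (?h j) (?h j)) * sqrt (ip n (?h l) (?h l)))"
    unfolding ip_def[of _ "?h j" "?h l"] sum_divide_distrib
    by (intro sum.cong) (use jl in \<open>auto simp: gs_mat_def\<close>)
  also have "\<dots> = (if j = l then 1 else 0)"
    using assms jl by (auto simp: gs_regular_def gs_vec_orthogonal ip_self_nonneg simp flip: real_sqrt_mult)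
  finally show "(\<Sum>i<n. gs_mat n x i j * gs_mat n x i l) = (if j = l then 1 else 0)" .
qed (auto simp: gs_mat_def)

lemma gs_vec_act:
  assumes "V \<in> orth_mats n"
  shows "gs_vec n (mat_cols n (mat_act n V x)) k = mat_vec n V (gs_vec n (mat_cols n x) k)"
  by (simp add: mat_cols_act[OF assms] gs_resid_mat_vec[OF assms])

lemma gs_regular_act:
  assumes "V \<in> orth_mats n" shows "gs_regular n (mat_act n V x) \<longleftrightarrow> gs_regular n x"
  by (simp add: gs_regular_def gs_vec_act[OF assms] ip_mat_vec[OF assms])

lemma gs_mat_act:
  assumes "V \<in> orth_mats n" shows "gs_mat n (mat_act n V x) = mat_mult n V (gs_mat n x)"
  unfolding gs_mat_def gs_vec_act[OF assms] ip_mat_vec[OF assms]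
  by (auto simp: fun_eq_iff mat_mult_def mat_vec_def sum_divide_distrib intro!: sum.cong)

lemma measurable_mat_coord:
  assumes "p \<in> I" shows "(\<lambda>x. x p) \<in> borel_measurable (lborel_fun I)"
  using measurable_component_singleton[OF assms, of "\<lambda>_. lborel"] by simp

lemma measurable_mat_cols [measurable]:
  "(\<lambda>x. mat_cols n x k i) \<in> borel_measurable (lborel_fun (mat_idx n))"
proof (cases "i < n \<and> k < n")
  case True
  then have "(\<lambda>x. x (i, k)) \<in> borel_measurable (lborel_fun (mat_idx n))"
    by (intro measurable_mat_coord) auto
  then show ?thesis using True by (simp add: mat_cols_def)
next
  case False
  then have "(\<lambda>x. mat_cols n x k i) = (\<lambda>x. 0)" by (auto simp: mat_cols_def)
  then show ?thesis by simp
qed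

text \<open>The vector is a measurable function \<open>w\<close> of the matrix, since the recursion
  also feeds in columns of the matrix itself.\<close>

lemma measurable_gs_resid:
  assumes "\<And>i. (\<lambda>x. w x i) \<in> borel_measurable (lborel_fun (mat_idx n))"
  shows "(\<lambda>x. gs_resid n (mat_cols n x) m (w x) i) \<in> borel_measurable (lborel_fun (mat_idx n))"
  using assms
proof (induction m arbitrary: w i)
  case (Suc m)
  have [measurable]: "(\<lambda>x. gs_resid n (mat_cols n x) m (w x) i) \<in> borel_measurable (lborel_fun (mat_idx n))" for i
    by (rule Suc.IH) (rule Suc.prems)
  have [measurable]: "(\<lambda>x. gs_resid n (mat_cols n x) m (mat_cols n x m) i) \<in> borel_measurable (lborel_fun (mat_idx n))" for i
    by (rule Suc.IH) measurable
  show ?case by (simp add: ip_def)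
qed simp

lemma measurable_gs_vec [measurable]:
  "(\<lambda>x. gs_vec n (mat_cols n x) k i) \<in> borel_measurable (lborel_fun (mat_idx n))"
  by (rule measurable_gs_resid) measurable

lemma measurable_gs_mat [measurable]:
  "(\<lambda>x. gs_mat n x i j) \<in> borel_measurable (lborel_fun (mat_idx n))"
  unfolding gs_mat_def ip_def by measurable

lemma measurable_gs_regular [measurable]:
  "Measurable.pred (lborel_fun (mat_idx n)) (gs_regular n)"
  unfolding gs_regular_def ip_def by measurable

lemma measurable_mat_act [measurable]:
  "mat_act n V \<in> measurable (lborel_fun (mat_idx n)) (lborel_fun (mat_idx n))"
  unfolding mat_act_def
proof (rule measurable_restrict)
  fix p assume p: "p \<in> mat_idx n"
  have "(\<lambda>x. x (k, snd p)) \<in> borel_measurable (lborel_fun (mat_idx n))" if "k < n" for k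
    using that p by (intro measurable_mat_coord) auto
  then show "(\<lambda>x. \<Sum>k<n. V (fst p) k * x (k, snd p)) \<in> measurable (lborel_fun (mat_idx n)) lborel"
    by auto
qed

text \<open>This is V V^T = I; it supplies the surjectivity required for invariance of Lebesgue
  measure.\<close>

lemma mat_act_transpose:
  assumes V: "V \<in> orth_mats n" and x: "x \<in> space (lborel_fun (mat_idx n))"
  shows "mat_act n V (mat_act n (mat_transpose V) x) = x"
proof
  fix p
  show "mat_act n V (mat_act n (mat_transpose V) x) p = x p"
  proof (cases "p \<in> mat_idx n")
    case True
    then obtain i j where p: "p = (i, j)" "i < n" "j < n" by auto
    have "mat_act n V (mat_act n (mat_transpose V) x) p = (\<Sum>k<n. \<Sum>l<n. V i k * V l k * x (l, j))"
      using p by (auto simp: mat_act_def mat_transpose_def sum_distrib_left mult_ac intro!: sum.cong)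
    also have "\<dots> = (\<Sum>l<n. \<Sum>k<n. V i k * V l k * x (l, j))" by (rule sum.swap)
    also have "\<dots> = (\<Sum>l<n. (if i = l then 1 else 0) * x (l, j))"
      using p by (intro sum.cong refl) (simp add: sum_distrib_right[symmetric] orth_matsD(2)[OF V])
    also have "\<dots> = x p" using p by (simp add: if_distrib[of "\<lambda>x. x * _"] cong: if_cong)
    finally show ?thesis .
  next
    case False
    then show ?thesis using x by (cases p) (auto simp: mat_act_def space_PiM PiE_iff extensional_def)
  qed
qed

lemma mat_act_norm:
  assumes V: "V \<in> orth_mats n"
  shows "(\<Sum>p\<in>mat_idx n. (mat_act n V x p)\<^sup>2) = (\<Sum>p\<in>mat_idx n. (x p)\<^sup>2)"
proof -
  have sw: "(\<Sum>p\<in>mat_idx n. (y p)\<^sup>2) = (\<Sum>j<n. \<Sum>i<n. y (i, j) * y (i, j))" for y :: "nat \<times> nat \<Rightarrow> real"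
    unfolding power2_eq_square
    by (subst sum.swap) (simp add: sum.cartesian_product case_prod_beta)
  have "(\<Sum>i<n. mat_act n V x (i, j) * mat_act n V x (i, j)) = (\<Sum>i<n. x (i, j) * x (i, j))" if "j < n" for j
    using mat_mult_cols_inner[OF V, of "\<lambda>i. x (i, j)" "\<lambda>i. x (i, j)"] that by (simp add: mat_act_def)
  then show ?thesis unfolding sw by simp
qed

text \<open>The radius makes room for all n^2 entries of absolute value at most 2, hence for the
  diagonally dominant box used below.\<close>

definition mat_ball :: "nat \<Rightarrow> (nat \<times> nat \<Rightarrow> real) set" where
  "mat_ball n = {x \<in> space (lborel_fun (mat_idx n)). (\<Sum>p\<in>mat_idx n. (x p)\<^sup>2) \<le> (2 * real n)\<^sup>2}"

lemma sets_mat_ball [measurable]: "mat_ball n \<in> sets (lborel_fun (mat_idx n))"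
proof -
  have "(\<lambda>x. \<Sum>p\<in>mat_idx n. (x p)\<^sup>2) \<in> borel_measurable (lborel_fun (mat_idx n))"
    by (intro borel_measurable_sum borel_measurable_power measurable_mat_coord)
  then show ?thesis unfolding mat_ball_def by measurable
qed

lemma emeasure_mat_ball_finite: "emeasure (lborel_fun (mat_idx n)) (mat_ball n) < \<infinity>"
proof -
  have "mat_ball n \<subseteq> PiE (mat_idx n) (\<lambda>_. {- 2 * real n .. 2 * real n})"
  proof
    fix x assume x: "x \<in> mat_ball n"
    have "x p \<in> {- 2 * real n .. 2 * real n}" if p: "p \<in> mat_idx n" for p
    proof -
      have "(x p)\<^sup>2 \<le> (\<Sum>p\<in>mat_idx n. (x p)\<^sup>2)" using p by (intro member_le_sum) auto
      also have "\<dots> \<le> (2 * real n)\<^sup>2" using x by (simp add: mat_ball_def)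
      finally have "\<bar>x p\<bar> \<le> 2 * real n" using abs_le_square_iff[of "x p" "2 * real n"] by simp
      then show ?thesis by auto
    qed
    then show "x \<in> PiE (mat_idx n) (\<lambda>_. {- 2 * real n .. 2 * real n})"
      using x by (auto simp: mat_ball_def space_PiM PiE_iff)
  qed
  then have "emeasure (lborel_fun (mat_idx n)) (mat_ball n)
      \<le> emeasure (lborel_fun (mat_idx n)) (PiE (mat_idx n) (\<lambda>_. {- 2 * real n .. 2 * real n}))"
    by (intro emeasure_mono sets_PiM_I_finite) auto
  also have "\<dots> < \<infinity>"
    by (subst emeasure_lborel_fun_box) (auto simp: ennreal_prod_eq_top less_top[symmetric] power_eq_top_ennreal)
  finally show ?thesis .
qed

definition gs_domain :: "nat \<Rightarrow> (nat \<times> nat \<Rightarrow> real) set" where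
  "gs_domain n = {x \<in> mat_ball n. gs_regular n x}"

lemma sets_gs_domain [measurable]: "gs_domain n \<in> sets (lborel_fun (mat_idx n))"
proof -
  have "gs_domain n = mat_ball n \<inter> {x \<in> space (lborel_fun (mat_idx n)). gs_regular n x}"
    by (auto simp: gs_domain_def mat_ball_def)
  also have "\<dots> \<in> sets (lborel_fun (mat_idx n))" by measurable
  finally show ?thesis .
qed

text \<open>Positivity comes from a box of strictly diagonally dominant matrices.\<close>

lemma emeasure_gs_domain_pos: "emeasure (lborel_fun (mat_idx n)) (gs_domain n) > 0"
proof -
  \<comment> \<open>The bounds 1 on the diagonal and 1/n off it are those of
    \<open>gs_vec_nonzero\<close>; the cap 2 keeps the box inside the ball and gives the diagonal
    sides positive length.\<close>
  define l u :: "nat \<times> nat \<Rightarrow> real" where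
    "l = (\<lambda>p. if fst p = snd p then 1 else - (1 / n))" and "u = (\<lambda>p. if fst p = snd p then 2 else 1 / n)"
  have "PiE (mat_idx n) (\<lambda>p. {l p..u p}) \<subseteq> gs_domain n"
  proof
    fix x assume x: "x \<in> PiE (mat_idx n) (\<lambda>p. {l p..u p})"
    have xlu: "l p \<le> x p" "x p \<le> u p" if "p \<in> mat_idx n" for p
      using PiE_mem[OF x that] by auto
    have "(x p)\<^sup>2 \<le> 2\<^sup>2" if "p \<in> mat_idx n" for p
    proof -
      have "1 / real n \<le> 1" using that by auto
      then have "\<bar>x p\<bar> \<le> 2" using xlu[OF that] by (auto simp: l_def u_def split: if_splits)
      then show ?thesis using abs_le_square_iff[of "x p" 2] by simp
    qed
    then have "(\<Sum>p\<in>mat_idx n. (x p)\<^sup>2) \<le> (\<Sum>p\<in>mat_idx n. 2\<^sup>2)" by (rule sum_mono)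
    also have "\<dots> = (2 * real n)\<^sup>2" by (simp add: power2_eq_square)
    finally have "x \<in> mat_ball n" using x by (auto simp: mat_ball_def space_PiM PiE_iff)
    moreover have "gs_regular n x"
      unfolding gs_regular_def
    proof (intro allI impI gs_vec_nonzero)
      show "1 \<le> mat_cols n x i i" if "i < n" for i
        using xlu[of "(i, i)"] that by (auto simp: mat_cols_def l_def)
      show "\<bar>mat_cols n x j i\<bar> \<le> 1 / n" if "i < n" "j < n" "i \<noteq> j" for i j
        using xlu[of "(i, j)"] that by (auto simp: mat_cols_def l_def u_def)
    qed
    ultimately show "x \<in> gs_domain n" by (simp add: gs_domain_def)
  qed
  then have "emeasure (lborel_fun (mat_idx n)) (PiE (mat_idx n) (\<lambda>p. {l p..u p}))
      \<le> emeasure (lborel_fun (mat_idx n)) (gs_domain n)"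
    by (intro emeasure_mono) auto
  moreover have "emeasure (lborel_fun (mat_idx n)) (PiE (mat_idx n) (\<lambda>p. {l p..u p})) \<noteq> 0"
    by (subst emeasure_lborel_fun_box) (auto simp: prod_zero_iff l_def u_def)
  ultimately show ?thesis by (auto simp: zero_less_iff_neq_zero)
qed

lemma emeasure_mat_act:
  assumes V: "V \<in> orth_mats n" and A: "A \<in> sets (lborel_fun (mat_idx n))"
  shows "emeasure (lborel_fun (mat_idx n)) {x \<in> space (lborel_fun (mat_idx n)). mat_act n V x \<in> A}
    = emeasure (lborel_fun (mat_idx n)) A"
proof (rule emeasure_lborel_fun_linear[where B = "mat_ball n"])
  let ?L = "lborel_fun (mat_idx n)"
  show "mat_act n V (fun_plus (mat_idx n) x y) = fun_plus (mat_idx n) (mat_act n V x) (mat_act n V y)" for x y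
    by (auto simp: mat_act_def fun_plus_def fun_eq_iff algebra_simps sum.distrib)
  show "\<exists>y\<in>space ?L. mat_act n V y = x" if "x \<in> space ?L" for x
    using that mat_act_transpose[OF V that] measurable_space[OF measurable_mat_act that] by blast
  show "fun_minus (mat_idx n) x y \<in> mat_ball n \<longleftrightarrow> fun_minus (mat_idx n) y x \<in> mat_ball n" for x y
    by (simp add: mat_ball_def fun_minus_def space_PiM power2_commute cong: sum.cong)
  show "mat_act n V x \<in> mat_ball n \<longleftrightarrow> x \<in> mat_ball n" if "x \<in> space ?L" for x
    using that measurable_space[OF measurable_mat_act that] by (simp add: mat_ball_def mat_act_norm[OF V])
  have "emeasure ?L (gs_domain n) \<le> emeasure ?L (mat_ball n)"
    by (intro emeasure_mono) (auto simp: gs_domain_def)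
  then show "emeasure ?L (mat_ball n) > 0" using emeasure_gs_domain_pos[of n] by (rule less_le_trans[rotated])
qed (use A emeasure_mat_ball_finite in auto)

lemma id_mat_orth: "(\<lambda>i j. if i = j \<and> i < n then 1 else 0) \<in> orth_mats n"
  by (rule col_orthonormal_imp_orth_mats) (auto simp: if_distrib[of "\<lambda>x. x * _"] cong: if_cong)

lemma haar_exists: "\<exists>\<mu>. is_haar_On n \<mu>"
proof -
  let ?L = "lborel_fun (mat_idx n)"
  define E :: "nat \<Rightarrow> nat \<Rightarrow> real" where "E = (\<lambda>i j. if i = j \<and> i < n then 1 else 0)"
  \<comment> \<open>The identity is a filler that makes \<open>Q\<close> map into the orthogonal
    group everywhere; the uniform measure gives no mass to the points that receive it.\<close>
  define Q where "Q x = (if x \<in> gs_domain n then gs_mat n x else E)" for x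
  define \<mu> where "\<mu> = distr (uniform_measure ?L (gs_domain n)) (orth_borel n) Q"
  have Q [measurable]: "Q \<in> measurable ?L (orth_borel n)"
  proof (rule measurable_orth_borelI)
    show "Q x \<in> orth_mats n" for x
      using id_mat_orth by (auto simp: Q_def E_def gs_domain_def intro: gs_mat_orth)
    show "(\<lambda>x. Q x i j) \<in> borel_measurable ?L" for i j
      unfolding Q_def if_distrib[of "\<lambda>f. f i j"] if_distribR by measurable
  qed
  have fin: "emeasure ?L (gs_domain n) \<noteq> \<infinity>"
  proof -
    have "emeasure ?L (gs_domain n) \<le> emeasure ?L (mat_ball n)"
      by (intro emeasure_mono) (auto simp: gs_domain_def)
    then show ?thesis using emeasure_mat_ball_finite[of n] by (auto simp: top_unique)
  qed
  have pos: "emeasure ?L (gs_domain n) \<noteq> 0" using emeasure_gs_domain_pos[of n] by auto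
  have S: "{x \<in> gs_domain n. Q x \<in> A} \<in> sets ?L" if [measurable]: "A \<in> sets (orth_borel n)" for A
  proof -
    have "{x \<in> gs_domain n. Q x \<in> A} = gs_domain n \<inter> {x \<in> space ?L. Q x \<in> A}"
      by (auto simp: gs_domain_def mat_ball_def)
    also have "\<dots> \<in> sets ?L" by measurable
    finally show ?thesis .
  qed
  have em: "emeasure \<mu> A = emeasure ?L {x \<in> gs_domain n. Q x \<in> A} / emeasure ?L (gs_domain n)"
    if A: "A \<in> sets (orth_borel n)" for A
  proof -
    have "emeasure \<mu> A = emeasure (uniform_measure ?L (gs_domain n)) (Q -` A \<inter> space ?L)"
      unfolding \<mu>_def by (subst emeasure_distr) (use A in auto)
    also have "\<dots> = emeasure ?L (gs_domain n \<inter> (Q -` A \<inter> space ?L)) / emeasure ?L (gs_domain n)"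
      by (rule emeasure_uniform_measure) (use measurable_sets[OF Q A] in auto)
    also have "gs_domain n \<inter> (Q -` A \<inter> space ?L) = {x \<in> gs_domain n. Q x \<in> A}"
      by (auto simp: gs_domain_def mat_ball_def)
    finally show ?thesis .
  qed
  have prob: "prob_space \<mu>"
    unfolding \<mu>_def by (rule prob_space.prob_space_distr) (use pos fin in \<open>auto intro: prob_space_uniform_measure\<close>)
  have "emeasure \<mu> (mat_mult n V -` A \<inter> space \<mu>) = emeasure \<mu> A"
    if V: "V \<in> orth_mats n" and A: "A \<in> sets (orth_borel n)" for V A
  proof -
    have eq: "mat_mult n V -` A \<inter> space \<mu> = {U \<in> orth_mats n. mat_mult n V U \<in> A}"
      by (auto simp: \<mu>_def)
    have act: "mat_act n V x \<in> space ?L" if "x \<in> space ?L" for x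
      using measurable_space[OF measurable_mat_act that] .
    have dom: "mat_act n V x \<in> gs_domain n \<longleftrightarrow> x \<in> gs_domain n" if "x \<in> space ?L" for x
      using that act by (simp add: gs_domain_def mat_ball_def mat_act_norm[OF V] gs_regular_act[OF V])
    \<comment> \<open>On the domain, \<open>Q\<close> intertwines \<open>mat_act n V\<close> with
      \<open>mat_mult n V\<close>, so invariance of the law reduces to that of Lebesgue
      measure.\<close>
    have eq': "{x \<in> gs_domain n. Q x \<in> {U \<in> orth_mats n. mat_mult n V U \<in> A}}
        = {x \<in> space ?L. mat_act n V x \<in> {x \<in> gs_domain n. Q x \<in> A}}"
    proof -
      have "gs_domain n \<subseteq> space ?L" by (auto simp: gs_domain_def mat_ball_def)
      moreover have "Q (mat_act n V x) = mat_mult n V (Q x) \<and> Q x \<in> orth_mats n" if "x \<in> gs_domain n" "x \<in> space ?L" for x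
        using that dom[of x] gs_mat_orth by (auto simp: Q_def gs_mat_act[OF V] gs_domain_def)
      ultimately show ?thesis using dom by auto
    qed
    show ?thesis
      unfolding eq em[OF A] em[OF sets_mat_mult_vimage[OF V A]] eq' emeasure_mat_act[OF V S[OF A]] ..
  qed
  then have "is_haar_On n \<mu>"
    using prob by (auto simp: is_haar_On_def \<mu>_def orth_borel_def)
  then show ?thesis ..
qed

lemma is_haar_haar_On: "is_haar_On n (haar_On n)"
proof -
  obtain \<mu> where \<mu>: "is_haar_On n \<mu>" using haar_exists by blast
  show ?thesis unfolding haar_On_def by (rule theI[of _ \<mu>]) (use \<mu> haar_unique in blast)+
qed

section \<open>Rotating two columns\<close>

lemma haar_On_measure:
  shows "prob_space (haar_On n)" "sets (haar_On n) = sets (orth_borel n)" "space (haar_On n) = orth_mats n"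
  using is_haar_OnD[OF is_haar_haar_On] by auto

lemma measurable_haar_On_iff [simp]:
  "f \<in> measurable (haar_On n) N \<longleftrightarrow> f \<in> measurable (orth_borel n) N"
  using measurable_cong_sets[OF haar_On_measure(2)] by auto

lemma distr_haar_On_mat_mult:
  assumes V: "V \<in> orth_mats n"
  shows "distr (haar_On n) (orth_borel n) (mat_mult n V) = haar_On n"
proof (rule measure_eqI)
  have m: "mat_mult n V \<in> measurable (orth_borel n) (orth_borel n)"
    using V by (intro measurable_mat_mult measurable_const) auto
  fix A assume "A \<in> sets (distr (haar_On n) (orth_borel n) (mat_mult n V))"
  then have A: "A \<in> sets (orth_borel n)" by simp
  have "mat_mult n V -` A \<inter> space (haar_On n) = {U \<in> orth_mats n. mat_mult n V U \<in> A}"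
    by (auto simp: haar_On_measure)
  then show "emeasure (distr (haar_On n) (orth_borel n) (mat_mult n V)) A = emeasure (haar_On n) A"
    using is_haar_OnD(4)[OF is_haar_haar_On V A] m A by (simp add: emeasure_distr)
qed (simp add: haar_On_measure)

lemma distr_haar_On_transpose:
  "distr (haar_On n) (orth_borel n) mat_transpose = haar_On n"
proof (rule measure_eqI)
  have m: "mat_transpose \<in> measurable (orth_borel n) (orth_borel n)"
    by (intro measurable_mat_transpose) auto
  fix A assume "A \<in> sets (distr (haar_On n) (orth_borel n) mat_transpose)"
  then have A: "A \<in> sets (orth_borel n)" by simp
  have "mat_transpose -` A \<inter> space (haar_On n) = {U \<in> orth_mats n. mat_transpose U \<in> A}"
    by (auto simp: haar_On_measure)
  then show "emeasure (distr (haar_On n) (orth_borel n) mat_transpose) A = emeasure (haar_On n) A"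
    using haar_transpose[OF is_haar_haar_On is_haar_haar_On A] m A by (simp add: emeasure_distr)
qed (simp add: haar_On_measure)

text \<open>Right multiplication by \<open>W\<close> is left multiplication by its transpose,
  conjugated by transposition, and each of these maps preserves the measure.\<close>

lemma integral_haar_On_mat_mult_right:
  fixes f :: "(nat \<Rightarrow> nat \<Rightarrow> real) \<Rightarrow> real"
  assumes W: "W \<in> orth_mats n" and f [measurable]: "f \<in> borel_measurable (orth_borel n)"
  shows "(\<integral>U. f (mat_mult n U W) \<partial>haar_On n) = (\<integral>U. f U \<partial>haar_On n)"
proof -
  have t: "mat_transpose \<in> measurable (orth_borel n) (orth_borel n)"
    by (intro measurable_mat_transpose) auto
  have l: "mat_mult n (mat_transpose W) \<in> measurable (orth_borel n) (orth_borel n)"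
    using W by (intro measurable_mat_mult measurable_const) auto
  have r: "(\<lambda>U. mat_mult n U W) \<in> measurable (orth_borel n) (orth_borel n)"
    using W by (intro measurable_mat_mult measurable_const) auto
  have tr: "(\<integral>U. h (mat_transpose U) \<partial>haar_On n) = (\<integral>U. h U \<partial>haar_On n)"
    if h: "h \<in> borel_measurable (orth_borel n)" for h :: "(nat \<Rightarrow> nat \<Rightarrow> real) \<Rightarrow> real"
    using integral_distr[of mat_transpose "haar_On n" "orth_borel n" h] t h
    by (simp add: distr_haar_On_transpose)
  have "(\<integral>U. f (mat_mult n U W) \<partial>haar_On n) = (\<integral>U. f (mat_mult n (mat_transpose U) W) \<partial>haar_On n)"
    by (rule tr[symmetric]) (rule measurable_compose[OF r f])
  also have "\<dots> = (\<integral>U. f (mat_transpose (mat_mult n (mat_transpose W) U)) \<partial>haar_On n)"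
    by (simp add: mat_transpose_mult)
  also have "\<dots> = (\<integral>U. f (mat_transpose U) \<partial>haar_On n)"
    using integral_distr[of "mat_mult n (mat_transpose W)" "haar_On n" "orth_borel n" "\<lambda>U. f (mat_transpose U)"]
      l measurable_compose[OF t f] W by (simp add: distr_haar_On_mat_mult)
  also have "\<dots> = (\<integral>U. f U \<partial>haar_On n)" by (rule tr[OF f])
  finally show ?thesis .
qed

text \<open>A Givens rotation given by its cosine \<alpha> and sine \<beta> instead of an angle, so
  that any unit vector may be inserted directly.\<close>

definition plane_rot :: "nat \<Rightarrow> nat \<Rightarrow> nat \<Rightarrow> real \<Rightarrow> real \<Rightarrow> nat \<Rightarrow> nat \<Rightarrow> real" where
  "plane_rot n i j \<alpha> \<beta> = (\<lambda>k l. if k < n \<and> l < n then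
     (if l = i then (if k = i then \<alpha> else if k = j then \<beta> else 0)
      else if l = j then (if k = i then - \<beta> else if k = j then \<alpha> else 0)
      else if k = l then 1 else 0) else 0)"

lemma sum_plane_rot:
  assumes "i \<noteq> j" "i < n" "j < n" "l < n"
  shows "(\<Sum>k<n. x k * plane_rot n i j \<alpha> \<beta> k l) =
    (if l = i then \<alpha> * x i + \<beta> * x j else if l = j then \<alpha> * x j - \<beta> * x i else x l)"
proof (cases "l = i \<or> l = j")
  case True
  then have "(\<Sum>k<n. x k * plane_rot n i j \<alpha> \<beta> k l) = (\<Sum>k\<in>{i, j}. x k * plane_rot n i j \<alpha> \<beta> k l)"
    using assms by (intro sum.mono_neutral_right) (auto simp: plane_rot_def)
  then show ?thesis using assms True by (auto simp: plane_rot_def)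
next
  case False
  then have "(\<Sum>k<n. x k * plane_rot n i j \<alpha> \<beta> k l) = (\<Sum>k\<in>{l}. x k * plane_rot n i j \<alpha> \<beta> k l)"
    using assms by (intro sum.mono_neutral_right) (auto simp: plane_rot_def)
  then show ?thesis using assms False by (auto simp: plane_rot_def)
qed

lemma plane_rot_orth:
  assumes "i \<noteq> j" "i < n" "j < n" and ab: "\<alpha>\<^sup>2 + \<beta>\<^sup>2 = 1"
  shows "plane_rot n i j \<alpha> \<beta> \<in> orth_mats n"
proof (rule col_orthonormal_imp_orth_mats)
  fix k l assume kl: "k < n" "l < n"
  show "(\<Sum>r<n. plane_rot n i j \<alpha> \<beta> r k * plane_rot n i j \<alpha> \<beta> r l) = (if k = l then 1 else 0)"
    unfolding sum_plane_rot[OF assms(1-3) kl(2)]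
    using assms kl by (auto simp: plane_rot_def power2_eq_square add.commute)
qed (auto simp: plane_rot_def)

lemma mat_mult_plane_rot:
  assumes "i \<noteq> j" "i < n" "j < n" "k < n" "l < n"
  shows "mat_mult n U (plane_rot n i j \<alpha> \<beta>) k l =
    (if l = i then \<alpha> * U k i + \<beta> * U k j else if l = j then \<alpha> * U k j - \<beta> * U k i else U k l)"
  using assms sum_plane_rot[of i j n l "U k"] by (simp add: mat_mult_def)

section \<open>Merging two columns\<close>

lemma dfact_pos: "dfact m > 0"
  by (induction m rule: dfact.induct) auto

text \<open>In this convention \<open>dfact (2 * j)\<close> is the product of the odd numbers below
  2j; the even factors of (2j)! contribute 2^j j!.\<close>

lemma fact_double: "fact (2 * j) = dfact (2 * j) * 2 ^ j * fact j"
  by (induction j) (auto simp: algebra_simps)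

text \<open>Splitting all factorials by \<open>fact_double\<close> cancels the powers of 2. The
  ratio of the two binomials, which arises when coefficients are compared, thus becomes a ratio of
  double factorials.\<close>

lemma choose_double_dfact:
  assumes "l \<le> m"
  shows "((2 * m) choose (2 * l)) * (dfact (2 * l) * dfact (2 * (m - l))) = (m choose l) * dfact (2 * m)"
proof -
  let ?C = "((2 * m) choose (2 * l)) * (dfact (2 * l) * dfact (2 * (m - l)))"
  have "fact (2 * l) * fact (2 * m - 2 * l) * ((2 * m) choose (2 * l)) = (fact (2 * m) :: nat)"
    by (rule binomial_fact_lemma) (use assms in simp)
  moreover have "fact l * fact (m - l) * (m choose l) = (fact m :: nat)"
    by (rule binomial_fact_lemma) (use assms in simp)
  moreover have "2 * m - 2 * l = 2 * (m - l)" by simp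
  ultimately have "(dfact (2 * l) * 2 ^ l * fact l) * (dfact (2 * (m - l)) * 2 ^ (m - l) * fact (m - l)) * ((2 * m) choose (2 * l))
      = dfact (2 * m) * 2 ^ m * (fact l * fact (m - l) * (m choose l))"
    by (metis fact_double)
  moreover have "(2::nat) ^ m = 2 ^ l * 2 ^ (m - l)" using assms by (simp flip: power_add)
  ultimately have "?C * (2 ^ l * 2 ^ (m - l) * fact l * fact (m - l))
      = (m choose l) * dfact (2 * m) * (2 ^ l * 2 ^ (m - l) * fact l * fact (m - l))"
    by (simp only: mult_ac)
  then show ?thesis by simp
qed

lemma integrable_haar_On_bounded:
  fixes f :: "(nat \<Rightarrow> nat \<Rightarrow> real) \<Rightarrow> real"
  assumes "f \<in> borel_measurable (orth_borel n)" "\<And>U. U \<in> orth_mats n \<Longrightarrow> \<bar>f U\<bar> \<le> B"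
  shows "integrable (haar_On n) f"
proof -
  interpret prob_space "haar_On n" by (rule haar_On_measure)
  show ?thesis
    by (rule integrable_const_bound[where B = B]) (use assms in \<open>auto simp: haar_On_measure intro!: AE_I2\<close>)
qed

text \<open>Rotating the columns \<open>i\<close> and \<open>j\<close> shows that \<open>E[w (x + s y)\<^sup>2\<^sup>m] = (1 + s\<^sup>2)\<^sup>m E[w x\<^sup>2\<^sup>m]\<close> for the
  entries \<open>x\<close>, \<open>y\<close> of row \<open>r\<close> in these columns; compare the coefficients of \<open>s\<close>.\<close>

lemma integral_haar_On_merge:
  fixes w :: "(nat \<Rightarrow> nat \<Rightarrow> real) \<Rightarrow> real"
  assumes ij: "i \<noteq> j" "i < n" "j < n" and r: "r < n"
    and w [measurable]: "w \<in> borel_measurable (orth_borel n)" and w_le: "\<And>U. U \<in> orth_mats n \<Longrightarrow> \<bar>w U\<bar> \<le> 1"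
    and w_rot: "\<And>U \<alpha> \<beta>. w (mat_mult n U (plane_rot n i j \<alpha> \<beta>)) = w U"
    and "even e" "even f"
  shows "dfact (e + f) * (\<integral>U. w U * (U r i ^ e * U r j ^ f) \<partial>haar_On n)
    = dfact e * dfact f * (\<integral>U. w U * U r i ^ (e + f) \<partial>haar_On n)"
proof -
  from \<open>even e\<close> \<open>even f\<close> obtain k l where kl: "e = 2 * k" "f = 2 * l" by (auto elim!: evenE)
  define m where "m = k + l"
  \<comment> \<open>All these moments have total degree 2m: \<open>M 0\<close> is the pure moment,
    \<open>M (2 * l)\<close> the mixed one.\<close>
  define M where "M q = (\<integral>U. w U * (U r i ^ (2 * m - q) * U r j ^ q) \<partial>haar_On n)" for q
  have int: "integrable (haar_On n) (\<lambda>U. w U * (U r i ^ p * U r j ^ q))" for p q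
  proof (rule integrable_haar_On_bounded[where B = 1])
    fix U assume U: "U \<in> orth_mats n"
    note 1 = w_le[OF U] orth_mats_entry_le_1[OF U, of r i] orth_mats_entry_le_1[OF U, of r j]
    have "\<bar>U r i ^ p * U r j ^ q\<bar> \<le> 1 * 1"
      unfolding abs_mult power_abs by (intro mult_mono power_le_one) (use 1 in auto)
    then have "\<bar>w U * (U r i ^ p * U r j ^ q)\<bar> \<le> 1 * 1"
      unfolding abs_mult[of "w U"] by (intro mult_mono) (use 1 in auto)
    then show "\<bar>w U * (U r i ^ p * U r j ^ q)\<bar> \<le> 1" by simp
  qed measurable
  have rot: "(\<integral>U. w U * (U r i + s * U r j) ^ (2 * m) \<partial>haar_On n) = (1 + s\<^sup>2) ^ m * M 0" for s
  proof -
    \<comment> \<open>The scaling that makes (c, s c) a unit vector; the corresponding rotation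
      sends x to c (x + s y).\<close>
    define c where "c = 1 / sqrt (1 + s\<^sup>2)"
    have pos: "1 + s\<^sup>2 > 0" by (simp add: add_pos_nonneg)
    have c2: "c\<^sup>2 * (1 + s\<^sup>2) = 1" using pos by (simp add: c_def power_divide)
    then have c1: "c\<^sup>2 + (s * c)\<^sup>2 = 1" by (simp add: algebra_simps power_mult_distrib)
    have "M 0 = (\<integral>U. w U * U r i ^ (2 * m) \<partial>haar_On n)" by (simp add: M_def)
    also have "\<dots> = (\<integral>U. w (mat_mult n U (plane_rot n i j c (s * c))) *
        mat_mult n U (plane_rot n i j c (s * c)) r i ^ (2 * m) \<partial>haar_On n)"
      by (rule integral_haar_On_mat_mult_right[symmetric, OF plane_rot_orth[OF ij c1]]) measurable
    also have "\<dots> = (\<integral>U. c ^ (2 * m) * (w U * (U r i + s * U r j) ^ (2 * m)) \<partial>haar_On n)"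
    proof (intro Bochner_Integration.integral_cong refl)
      fix U
      have "mat_mult n U (plane_rot n i j c (s * c)) r i = c * (U r i + s * U r j)"
        using mat_mult_plane_rot[OF ij r ij(2)] by (simp add: algebra_simps)
      then show "w (mat_mult n U (plane_rot n i j c (s * c))) *
          mat_mult n U (plane_rot n i j c (s * c)) r i ^ (2 * m) = c ^ (2 * m) * (w U * (U r i + s * U r j) ^ (2 * m))"
        by (simp add: w_rot power_mult_distrib)
    qed
    also have "\<dots> = (c\<^sup>2) ^ m * (\<integral>U. w U * (U r i + s * U r j) ^ (2 * m) \<partial>haar_On n)"
      by (simp add: power_mult)
    finally have "(1 + s\<^sup>2) ^ m * M 0 = (c\<^sup>2 * (1 + s\<^sup>2)) ^ m * (\<integral>U. w U * (U r i + s * U r j) ^ (2 * m) \<partial>haar_On n)"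
      by (simp add: power_mult_distrib)
    then show ?thesis by (simp add: c2)
  qed
  \<comment> \<open>The coefficients of (1 + s^2)^m \<open>M 0\<close> as a polynomial in s.\<close>
  define d where "d q = (if even q then (m choose (q div 2)) * M 0 else 0)" for q
  have "(\<Sum>q\<le>2*m. ((2 * m choose q) * M q) * s ^ q) = (\<Sum>q\<le>2*m. d q * s ^ q)" for s
  proof -
    have "(\<Sum>q\<le>2*m. ((2 * m choose q) * M q) * s ^ q)
        = (\<Sum>q\<le>2*m. (\<integral>U. (2 * m choose q) * s ^ q * (w U * (U r i ^ (2 * m - q) * U r j ^ q)) \<partial>haar_On n))"
      unfolding M_def integral_mult_right_zero by (simp only: mult_ac)
    also have "\<dots> = (\<integral>U. (\<Sum>q\<le>2*m. (2 * m choose q) * s ^ q * (w U * (U r i ^ (2 * m - q) * U r j ^ q))) \<partial>haar_On n)"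
      by (rule Bochner_Integration.integral_sum[symmetric]) (intro integrable_mult_right int)
    also have "\<dots> = (\<integral>U. w U * (U r i + s * U r j) ^ (2 * m) \<partial>haar_On n)"
    proof (intro Bochner_Integration.integral_cong refl)
      fix U
      have "(U r i + s * U r j) ^ (2 * m) = (s * U r j + U r i) ^ (2 * m)" by (simp add: add.commute)
      also have "\<dots> = (\<Sum>q\<le>2*m. (2 * m choose q) * (s * U r j) ^ q * U r i ^ (2 * m - q))"
        by (rule binomial_ring)
      finally show "(\<Sum>q\<le>2*m. (2 * m choose q) * s ^ q * (w U * (U r i ^ (2 * m - q) * U r j ^ q)))
          = w U * (U r i + s * U r j) ^ (2 * m)"
        by (simp add: sum_distrib_left power_mult_distrib mult_ac)
    qed
    also have "\<dots> = (s\<^sup>2 + 1) ^ m * M 0" by (simp add: rot add.commute)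
    also have "\<dots> = (\<Sum>q\<le>m. d (2 * q) * s ^ (2 * q))"
      unfolding binomial_ring sum_distrib_right by (intro sum.cong refl) (simp add: d_def power_mult)
    also have "\<dots> = (\<Sum>q\<in>(\<lambda>q. 2 * q) ` {..m}. d q * s ^ q)"
      by (subst sum.reindex) (auto simp: inj_on_def)
    also have "\<dots> = (\<Sum>q\<le>2*m. d q * s ^ q)"
      by (rule sum.mono_neutral_left) (auto simp: d_def image_iff elim!: evenE)
    finally show ?thesis .
  qed
  then have "\<forall>q\<le>2*m. (2 * m choose q) * M q = d q"
    using polyfun_eq_coeffs[of "\<lambda>q. (2 * m choose q) * M q" "2 * m" d] by blast
  then have "(2 * m choose (2 * l)) * M (2 * l) = (m choose l) * M 0"
    by (auto simp: d_def m_def)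
  then have "real (dfact (2 * l) * dfact (2 * k)) * ((m choose l) * M 0)
      = real ((2 * m choose (2 * l)) * (dfact (2 * l) * dfact (2 * (m - l)))) * M (2 * l)"
    by (simp add: m_def mult_ac)
  also have "\<dots> = (m choose l) * (dfact (2 * m) * M (2 * l))"
    by (subst choose_double_dfact) (simp_all add: m_def)
  finally have "dfact (2 * m) * M (2 * l) = dfact (2 * l) * dfact (2 * k) * M 0"
    by (simp add: m_def)
  then show ?thesis by (simp add: M_def m_def kl mult_ac add_mult_distrib2)
qed

text \<open>The zeros in the second row leave only first-row powers in the last two columns; all
  earlier columns go into the weight \<open>w\<close>, which a rotation of these two does not
  touch.\<close>

lemma I_n_merge:
  assumes "length b = length a" "length a + 2 \<le> n" "even x" "even y"
  shows "dfact (x + y) * I_n n (a @ [x, y]) (b @ [0, 0]) = dfact x * dfact y * I_n n (a @ [x + y]) (b @ [0])"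
proof -
  let ?p = "length a"
  define w :: "(nat \<Rightarrow> nat \<Rightarrow> real) \<Rightarrow> real" where "w U = (\<Prod>j<?p. U 0 j ^ (a ! j) * U 1 j ^ (b ! j))" for U
  have 1: "I_n n (a @ [x, y]) (b @ [0, 0]) = (\<integral>U. w U * (U 0 ?p ^ x * U 0 (Suc ?p) ^ y) \<partial>haar_On n)"
    unfolding I_n_def w_def using assms(1) by (simp add: nth_append mult.assoc cong: prod.cong_simp)
  have 2: "I_n n (a @ [x + y]) (b @ [0]) = (\<integral>U. w U * U 0 ?p ^ (x + y) \<partial>haar_On n)"
    unfolding I_n_def w_def using assms(1) by (simp add: nth_append cong: prod.cong_simp)
  show ?thesis
    unfolding 1 2
  proof (rule integral_haar_On_merge)
    show "w \<in> borel_measurable (orth_borel n)" unfolding w_def by measurable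
    show "\<bar>w U\<bar> \<le> 1" if U: "U \<in> orth_mats n" for U
      unfolding w_def abs_prod abs_mult power_abs
      by (intro prod_le_1 conjI mult_nonneg_nonneg mult_le_one power_le_one)
        (use orth_mats_entry_le_1[OF U] in auto)
    show "w (mat_mult n U (plane_rot n ?p (Suc ?p) \<alpha> \<beta>)) = w U" for U \<alpha> \<beta>
      unfolding w_def using assms by (intro prod.cong refl) (simp add: mat_mult_plane_rot)
  qed (use assms in auto)
qed

lemma I_n_merge_all:
  assumes "length b = length a" "length a + length c \<le> n" "\<forall>x\<in>set c. even x"
  shows "dfact (sum_list c) * I_n n (a @ c) (b @ replicate (length c) 0)
    = (\<Prod>x\<leftarrow>c. real (dfact x)) * I_n n (a @ [sum_list c]) (b @ [0])"
proof (cases c)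
  case Nil
  \<comment> \<open>The extra column may lie just outside the matrix when
    \<open>length a = n\<close>, but its exponents are 0, so its factor is 1 even where the entries
    are 0.\<close>
  then show ?thesis using assms(1) by (simp add: I_n_def nth_append cong: prod.cong_simp)
next
  case (Cons c0 c')
  then have "length c = Suc (length c')" by simp
  moreover have ?thesis if "length c = Suc k" for k
    using that assms(2,3)
  proof (induction k arbitrary: c)
    case 0
    then obtain x where "c = [x]" by (auto simp: length_Suc_conv)
    then show ?case by simp
  next
    case (Suc k)
    from Suc.prems(1) obtain d y where "c = d @ [y]" "length d = Suc k" by (metis length_Suc_conv_rev)
    moreover from this obtain d' x where "d = d' @ [x]" by (metis length_Suc_conv_rev)
    ultimately have c: "c = d' @ [x, y]" and d: "length d' = k" by auto
    have ev: "even x" "even y" using Suc.prems(3) by (auto simp: c)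
    have rep: "replicate (length c) 0 = replicate k 0 @ [0, 0 :: nat]"
      using replicate_add[of k 2 "0 :: nat"] d by (simp add: c numeral_2_eq_2)
    have rep': "replicate (length (d' @ [x + y])) 0 = replicate k 0 @ [0 :: nat]"
      using replicate_add[of k 1 "0 :: nat"] d by simp
    \<comment> \<open>Merging the last two entries shortens the list and keeps its sum and the
      evenness of its entries, so the induction hypothesis covers the merged list.\<close>
    have IH: "dfact (sum_list c) * I_n n (a @ d' @ [x + y]) (b @ replicate k 0 @ [0])
        = (\<Prod>x\<leftarrow>d'. real (dfact x)) * dfact (x + y) * I_n n (a @ [sum_list c]) (b @ [0])"
      using Suc.IH[of "d' @ [x + y]", unfolded rep'] Suc.prems ev d by (simp add: c add.assoc)
    have M: "dfact (x + y) * I_n n (a @ c) (b @ replicate (length c) 0)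
        = dfact x * dfact y * I_n n (a @ d' @ [x + y]) (b @ replicate k 0 @ [0])"
      using I_n_merge[of "b @ replicate k 0" "a @ d'" n x y] assms(1) Suc.prems ev d
      unfolding rep by (simp add: c)
    \<comment> \<open>The factor \<open>dfact (x + y)\<close> occurs in both the merging step and
      the induction hypothesis; being positive, it cancels at the end.\<close>
    have "dfact (x + y) * (dfact (sum_list c) * I_n n (a @ c) (b @ replicate (length c) 0))
        = dfact x * dfact y * (dfact (sum_list c) * I_n n (a @ d' @ [x + y]) (b @ replicate k 0 @ [0]))"
      using M by (simp add: mult_ac)
    also have "\<dots> = dfact (x + y) * ((\<Prod>x\<leftarrow>c. real (dfact x)) * I_n n (a @ [sum_list c]) (b @ [0]))"
      unfolding IH by (simp add: c mult_ac)
    finally show ?case using dfact_pos[of "x + y"] by simp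
  qed
  ultimately show ?thesis by blast
qed

theorem theorem3p4:
  fixes a b c :: "nat list" and n :: nat
  assumes "length b = length a"
    and "\<forall>x\<in>set a. even x" and "\<forall>x\<in>set b. even x" and "\<forall>x\<in>set c. even x"
    and "max 2 (length a + length c) \<le> n"
  shows "Phi_n n (a @ c) (b @ replicate (length c) 0) = Phi_n n (a @ [sum_list c]) (b @ [0])"
proof -
  let ?P = "\<lambda>c. \<Prod>x\<leftarrow>c. real (dfact x)"
  have nz: "?P c \<noteq> 0" "dfact (sum_list c) \<noteq> 0"
    using dfact_pos by (auto simp: prod_list_zero_iff) (metis less_irrefl)
  have "I_n n (a @ c) (b @ replicate (length c) 0) / ?P c = I_n n (a @ [sum_list c]) (b @ [0]) / dfact (sum_list c)"
    using I_n_merge_all[of b a c n] assms nz by (simp add: field_simps)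
  \<comment> \<open>Both matrices have the same row sums, and every zero contributes
    \<open>dfact 0 = 1\<close>; the two sides differ only in the quotient isolated on the
    right.\<close>
  moreover have "Phi_n n (a @ c) (b @ replicate (length c) 0) =
      real (dfact (sum_list a + sum_list c + n - 2) * dfact (sum_list b + n - 2)) /
      (real (dfact (n - 2)) ^ 2 * ?P a * ?P b) * (I_n n (a @ c) (b @ replicate (length c) 0) / ?P c)"
    by (simp add: Phi_n_def sum_list_replicate mult_ac)
  moreover have "Phi_n n (a @ [sum_list c]) (b @ [0]) =
      real (dfact (sum_list a + sum_list c + n - 2) * dfact (sum_list b + n - 2)) /
      (real (dfact (n - 2)) ^ 2 * ?P a * ?P b) * (I_n n (a @ [sum_list c]) (b @ [0]) / dfact (sum_list c))"
    by (simp add: Phi_n_def mult_ac)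
  ultimately show ?thesis by simp
qed

end
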